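(* Let $l\in\mathbb{N}$, let $s\in\mathbb{N}$ with $s\ge2l+1$, and let $H(x)=x^{l+1}+\sum_{j=l+2}^s h_jx^j\in\boldsymbol{k}[[x]]_s$. Assume that $T\in\Gamma^s_1$ transforms $(\mathrm{AJ}_s(H))$ to $(\mathrm{AJ}_s(\widetilde H))$, where $\widetilde H(x)=x^{l+1}+\delta x^{2l+1}$ with some $\delta\in\boldsymbol{k}$. Let $r\in\mathbb{N}$ be the largest positive integer with $rl+1\le s$, and let $Q^{l+1}_{pl+1}$ be the universal polynomials defined in the context. For $c\in\boldsymbol{k}$ put $\widetilde\Phi_c(x)=x+cx^{l+1}+\sum_{p=2}^{r}Q^{l+1}_{pl+1}(c,\delta)x^{pl+1}\in\Gamma^s$ (this is $\pi^\infty_s$ of the unique element of $\mathcal{S}_1(\mathrm{AJ}_\infty(\widetilde H))$ with coefficient $c$ at $x^{l+1}$), and for $b_{s-l+1},\dots,b_s\in\boldsymbol{k}$ put $\overline\Phi_{b_{s-l+1},\dots,b_s}(x)=x+\sum_{j=s-l+1}^s b_jx^j\in\mathcal{S}^l_1(\mathrm{AJ}_s(\widetilde H))$. (i) For every $c_1\in\boldsymbol{E}_l$ and $c_{l+1},c_{s-l+1},\dots,c_s\in\boldsymbol{k}$, $$ \begin{aligned} \widehat\Phi_{c_1,c_{l+1},c_{s-l+1},\dots,c_s}(x)&=\big(L_{c_1}\circ(\widetilde\Phi_{c_1^{-1}c_{l+1}}\circ\overline\Phi_{c_1^{-1}c_{s-l+1},\dots,c_1^{-1}c_s})\big)(x)\\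 &=c_1x+c_{l+1}x^{l+1}+\sum_{p=2}^{r-1}c_1Q^{l+1}_{pl+1}(c_1^{-1}c_{l+1},\delta)x^{pl+1}+\sum_{j=s-l+1}^{rl}c_jx^j\\ &\quad+\big(c_1Q^{l+1}_{rl+1}(c_1^{-1}c_{l+1},\delta)+c_{rl+1}\big)x^{rl+1}+\sum_{j=rl+2}^s c_jx^j \end{aligned} $$ belongs to $\mathcal{S}(\mathrm{AJ}_s(\widetilde H))$, and every element of $\mathcal{S}(\mathrm{AJ}_s(\widetilde H))$ is of this form for unique parameters $(c_1,c_{l+1},c_{s-l+1},\dots,c_s)\in\boldsymbol{E}_l\times\boldsymbol{k}^{l+1}$. The group $\mathcal{S}(\mathrm{AJ}_s(\widetilde H))$ is the semidirect product of the subgroup $\mathcal{L}_l$ and the normal subgroup which is the direct product of the subgroups $\pi^\infty_s\mathcal{S}_1(\mathrm{AJ}_\infty(\widetilde H))$ and $\mathcal{S}^l_1(\mathrm{AJ}_s(\widetilde H))$; it is isomorphic to $(\boldsymbol{E}_l\times\boldsymbol{k}^{l+1},\overline\diamond)$. (ii) For every $c_1\in\boldsymbol{E}_l$ and $c_{l+1},c_{s-l+1},\dots,c_s\in\boldsymbol{k}$, $$ \begin{aligned} \Phi_{c_1,c_{l+1},c_{s-l+1},\dots,c_s}&=T\circ\widehat\Phi_{c_1,c_{l+1},c_{s-l+1},\dots,c_s}\circ T^{-1}\\ &=(T\circ L_{c_1}\circ T^{-1})\circ(T\circ\widetilde\Phi_{c_1^{-1}c_{l+1}}\circ T^{-1})\circ(T\circ\overline\Phi_{c_1^{-1}c_{s-l+1},\dots,c_1^{-1}c_s}\circ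 T^{-1}) \end{aligned} $$ is a solution of $(\mathrm{AJ}_s(H))$, and every element of $\mathcal{S}(\mathrm{AJ}_s(H))$ is of this form for unique parameters. Writing $A^{T}=\{T\circ F\circ T^{-1}:F\in A\}$, the group $\mathcal{S}(\mathrm{AJ}_s(H))$ is the semidirect product of the subgroup $\mathcal{L}_l^{T}$ and the normal subgroup which is the direct product of the subgroups $(\pi^\infty_s\mathcal{S}_1(\mathrm{AJ}_\infty(\widetilde H)))^{T}$ and $(\mathcal{S}^l_1(\mathrm{AJ}_s(\widetilde H)))^{T}$; it is also isomorphic to $(\boldsymbol{E}_l\times\boldsymbol{k}^{l+1},\overline\diamond)$.
   Context: $\boldsymbol{k}$ is a field of characteristic $0$, $\boldsymbol{q}\subset\boldsymbol{k}$ its prime field. $\boldsymbol{k}[[x]]_\infty:=\boldsymbol{k}[[x]]$; for $s\in\mathbb{N}$, $\boldsymbol{k}[[x]]_s=\boldsymbol{k}[[x]]/(x^{s+1})$, with elements identified with polynomials $\sum_{j=0}^s c_jx^j$ and operations (including substitution) computed modulo $x^{s+1}$. For $s\in\mathbb{N}\cup\{\infty\}$, $\Gamma^s$ is the group (under substitution $\circ$) of $f\in\boldsymbol{k}[[x]]_s$ of order exactly $1$, $\Gamma^s_1=\{f\in\Gamma^s: f(x)\equiv x \bmod x^2\}$; inverses $T^{-1}$ are with respect to substitution. $\pi^\infty_s$ is truncation $\boldsymbol{k}[[x]]\to\boldsymbol{k}[[x]]_s$. $\boldsymbol{E}_l=\{c\in\boldsymbol{k}:c^l=1\}$, $L_c(x)=cx$,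 $\mathcal{L}_l=\{L_c:c\in\boldsymbol{E}_l\}$. $(\mathrm{AJ}_s(H))$ is the equation $(H\circ\Phi)(x)=\frac{d\Phi}{dx}\cdot H(x)$ (mod $x^{s+1}$ if $s<\infty$); $\mathcal{S}(\mathrm{AJ}_s(H))$ is the group of its solutions $\Phi\in\Gamma^s$; $\mathcal{S}_1(\mathrm{AJ}_s(H))=\mathcal{S}(\mathrm{AJ}_s(H))\cap\Gamma^s_1$. For finite $s$, $\mathcal{S}^l_1(\mathrm{AJ}_s(\widetilde H))=\{x+\sum_{i=s-l+1}^s c_ix^i:c_{s-l+1},\dots,c_s\in\boldsymbol{k}\}$. $T\in\Gamma^s_1$ transforms $(\mathrm{AJ}_s(H))$ to $(\mathrm{AJ}_s(\widetilde H))$ if $\widetilde H(x)=\left(\frac{dT}{dx}\right)^{-1}(H\circ T)(x)$ mod $x^{s+1}$ (multiplicative inverse of $dT/dx$). The operation $\overline\diamond$ on $\boldsymbol{E}_l\times\boldsymbol{k}^{l+1}$, with the $\boldsymbol{k}^{l+1}$-coordinates indexed by $J=\{l+1\}\cup\{s-l+1,\dots,s\}$, is $(c_1,(c_j)_{j\in J})\,\overline\diamond\,(d_1,(d_j)_{j\in J})=(c_1d_1,(c_1d_j+d_1^{\,j}c_j)_{j\in J})$. A group $G$ is the semidirect product of a subgroup $H_1$ and a normal subgroup $H_2$ if $G=H_1H_2$ and $H_1\cap H_2$ is trivial (direct if both are normal). Empty sums are $0$. For $1\le i\le n$: $U_{n,i}=\{\overline{u}_n=(u_1,\dots,u_n)\in\{0,\dots,i\}^n:\sum_{j=1}^n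 u_j=i,\ \sum_{j=1}^n ju_j=n\}$ and $B_{\overline{u}_n}=i!/\prod_{j=1}^n u_j!$ for $\overline u_n\in U_{n,i}$. $U^{l+1}_{n,i}$ is the set of $\overline{u}_n\in U_{n,i}$ such that $u_j=0$ for all $j\in\{2,\dots,n-i+1\}$ with $j\not\equiv1\pmod l$ and for all $j\in\{n-i+2,\dots,n\}$. $\check{U}^{l+1}_{n,l+1}$ is the set of $\overline{u}_n\in U^{l+1}_{n,l+1}$ with moreover $u_{n-l}=0$. The polynomials $Q^{l+1}_{ql+1}(y,t)\in\boldsymbol{q}[y,t]$, $q\ge1$, are defined by $Q^{l+1}_{l+1}(y,t)=y$ and, for $q\ge2$ with $n=(q+1)l+1$, $$Q^{l+1}_{ql+1}=\frac{1}{(q-1)l}\Big(\sum_{\overline{u}_n\in\check{U}^{l+1}_{n,l+1}}B_{\overline{u}_n}\prod_{j=1}^{q-1}(Q^{l+1}_{jl+1})^{u_{jl+1}}+t\sum_{\overline{u}_n\in U^{l+1}_{n,2l+1}}B_{\overline{u}_n}\prod_{j=1}^{q-1}(Q^{l+1}_{jl+1})^{u_{jl+1}}-t((q-1)l+1)Q^{l+1}_{(q-1)l+1}\Big).$$ *)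

theory Defs
  imports
    "HOL-Library.Extended_Nat"
    "HOL-Library.FuncSet"
    "HOL-Computational_Algebra.Polynomial"
    "HOL-Computational_Algebra.Formal_Power_Series"
    "HOL-Algebra.Coset"
begin

section \<open>Truncated power series under substitution\<close>

text \<open>
  For finite \<open>s\<close>, an element of \<open>k[[x]] / (x ^ (s+1))\<close> is represented by its unique
  representative of degree at most \<open>s\<close>, i.e. by a power series whose coefficients beyond \<open>s\<close>
  vanish; \<open>fps_trunc s\<close> reduces to this representative and is the identity for \<open>s = \<infinity>\<close>.
\<close>

definition fps_trunc :: "enat \<Rightarrow> 'a::zero fps \<Rightarrow> 'a fps" where
  "fps_trunc s f = Abs_fps (\<lambda>j. if enat j \<le> s then fps_nth f j else 0)"

definition subst_group :: "enat \<Rightarrow> 'a::field_char_0 fps monoid" where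
  "subst_group s =
     \<lparr>carrier = {f. fps_trunc s f = f \<and> subdegree f = 1},
      monoid.mult = (\<lambda>f g. fps_trunc s (f oo g)),
      one = fps_X\<rparr>"

definition subst_group1 :: "enat \<Rightarrow> 'a::field_char_0 fps set" where
  "subst_group1 s = {f \<in> carrier (subst_group s). fps_nth f 1 = 1}"

definition conj_set :: "('g, 'm) monoid_scheme \<Rightarrow> 'g \<Rightarrow> 'g set \<Rightarrow> 'g set" where
  "conj_set G t A = {t \<otimes>\<^bsub>G\<^esub> f \<otimes>\<^bsub>G\<^esub> inv\<^bsub>G\<^esub> t | f. f \<in> A}"

definition internal_semidirect :: "('g, 'm) monoid_scheme \<Rightarrow> 'g set \<Rightarrow> 'g set \<Rightarrow> bool" where
  "internal_semidirect G H N \<longleftrightarrow>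
     subgroup H G \<and> N \<lhd> G \<and> carrier G = H <#>\<^bsub>G\<^esub> N \<and> H \<inter> N = {\<one>\<^bsub>G\<^esub>}"

definition internal_direct :: "('g, 'm) monoid_scheme \<Rightarrow> 'g set \<Rightarrow> 'g set \<Rightarrow> bool" where
  "internal_direct G H N \<longleftrightarrow> internal_semidirect G H N \<and> H \<lhd> G"


section \<open>Aczel--Jabotinsky equations\<close>

definition AJ_sols :: "enat \<Rightarrow> 'a::field_char_0 fps \<Rightarrow> 'a fps set" where
  "AJ_sols s H =
     {\<Phi> \<in> carrier (subst_group s). fps_trunc s (H oo \<Phi>) = fps_trunc s (fps_deriv \<Phi> * H)}"

definition AJ_sols1 :: "enat \<Rightarrow> 'a::field_char_0 fps \<Rightarrow> 'a fps set" where
  "AJ_sols1 s H = AJ_sols s H \<inter> subst_group1 s"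

definition AJ_group :: "enat \<Rightarrow> 'a::field_char_0 fps \<Rightarrow> 'a fps monoid" where
  "AJ_group s H = (subst_group s)\<lparr>carrier := AJ_sols s H\<rparr>"

definition AJ_transforms :: "enat \<Rightarrow> 'a::field_char_0 fps \<Rightarrow> 'a fps \<Rightarrow> 'a fps \<Rightarrow> bool" where
  "AJ_transforms s T H H' \<longleftrightarrow> H' = fps_trunc s (inverse (fps_deriv T) * (H oo T))"

definition roots1 :: "nat \<Rightarrow> 'a::field_char_0 set" where
  "roots1 l = {c. c ^ l = 1}"

definition lin :: "'a::field_char_0 \<Rightarrow> 'a fps" where
  "lin c = fps_const c * fps_X"

definition bar_Phi :: "nat \<Rightarrow> nat \<Rightarrow> (nat \<Rightarrow> 'a::field_char_0) \<Rightarrow> 'a fps" where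
  "bar_Phi l s b = fps_X + (\<Sum>j = s - l + 1..s. fps_const (b j) * fps_X ^ j)"

definition AJ_top_sols :: "nat \<Rightarrow> nat \<Rightarrow> 'a::field_char_0 fps set" where
  "AJ_top_sols l s = {bar_Phi l s b | b. True}"


section \<open>The universal polynomials\<close>

definition U :: "nat \<Rightarrow> nat \<Rightarrow> (nat \<Rightarrow> nat) set" where
  "U n i = {u \<in> {1..n} \<rightarrow>\<^sub>E {0..i}. (\<Sum>j = 1..n. u j) = i \<and> (\<Sum>j = 1..n. j * u j) = n}"

definition B :: "nat \<Rightarrow> nat \<Rightarrow> (nat \<Rightarrow> nat) \<Rightarrow> rat" where
  "B n i u = fact i / (\<Prod>j = 1..n. fact (u j))"

text \<open>\<open>U_res l n i\<close> and \<open>U_check l n\<close> are \<open>U^{l+1}_{n,i}\<close> and the checked \<open>U^{l+1}_{n,l+1}\<close>.\<close>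

definition U_res :: "nat \<Rightarrow> nat \<Rightarrow> nat \<Rightarrow> (nat \<Rightarrow> nat) set" where
  "U_res l n i = {u \<in> U n i.
     (\<forall>j \<in> {2..n - i + 1}. j mod l \<noteq> 1 mod l \<longrightarrow> u j = 0) \<and> (\<forall>j \<in> {n - i + 2..n}. u j = 0)}"

definition U_check :: "nat \<Rightarrow> nat \<Rightarrow> (nat \<Rightarrow> nat) set" where
  "U_check l n = {u \<in> U_res l n (l + 1). u (n - l) = 0}"

text \<open>
  Polynomials in \<open>y\<close>, \<open>t\<close> over the prime field are elements of \<open>\<rat>[y][t]\<close>: the inner variable
  is \<open>y\<close>, the outer one is \<open>t\<close>. The prime field of a field of characteristic 0 is the image
  of \<open>of_rat\<close>.
\<close>

abbreviation pvar_y :: "rat poly poly" where "pvar_y \<equiv> [:[:0, 1:]:]"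
abbreviation pvar_t :: "rat poly poly" where "pvar_t \<equiv> [:0, 1:]"
abbreviation pconst :: "rat \<Rightarrow> rat poly poly" where "pconst c \<equiv> [:[:c:]:]"

definition eval_yt :: "rat poly poly \<Rightarrow> 'a::field_char_0 \<Rightarrow> 'a \<Rightarrow> 'a" where
  "eval_yt P a b = poly (map_poly (\<lambda>p. poly (map_poly of_rat p) a) P) b"

text \<open>\<open>Q l q\<close> is \<open>Q^{l+1}_{ql+1}\<close>, for \<open>q \<ge> 1\<close>; the value at \<open>q = 0\<close> is a dummy.\<close>

function Q :: "nat \<Rightarrow> nat \<Rightarrow> rat poly poly" where
  "Q l q =
    (if q = 0 then 0
     else if q = 1 then pvar_y
     else let n = (q + 1) * l + 1 in
       pconst (1 / of_nat ((q - 1) * l)) *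
         ((\<Sum>u \<in> U_check l n. pconst (B n (l + 1) u) * (\<Prod>j = 1..q - 1. Q l j ^ u (j * l + 1)))
          + pvar_t * (\<Sum>u \<in> U_res l n (2 * l + 1).
              pconst (B n (2 * l + 1) u) * (\<Prod>j = 1..q - 1. Q l j ^ u (j * l + 1)))
          - pvar_t * of_nat ((q - 1) * l + 1) * Q l (q - 1)))"
  by pat_completeness auto
termination
  by (relation "measure snd") auto

declare Q.simps [simp del]

definition tilde_Phi :: "nat \<Rightarrow> nat \<Rightarrow> 'a::field_char_0 \<Rightarrow> 'a \<Rightarrow> 'a fps" where
  "tilde_Phi l r \<delta> c =
     fps_X + fps_const c * fps_X ^ (l + 1)
       + (\<Sum>p = 2..r. fps_const (eval_yt (Q l p) c \<delta>) * fps_X ^ (p * l + 1))"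


section \<open>Parameters\<close>

definition J :: "nat \<Rightarrow> nat \<Rightarrow> nat set" where
  "J l s = {l + 1} \<union> {s - l + 1..s}"

definition diamond_group :: "nat \<Rightarrow> nat \<Rightarrow> ('a::field_char_0 \<times> (nat \<Rightarrow> 'a)) monoid" where
  "diamond_group l s =
     \<lparr>carrier = roots1 l \<times> (J l s \<rightarrow>\<^sub>E UNIV),
      monoid.mult = (\<lambda>(c1, c) (d1, d). (c1 * d1, \<lambda>j \<in> J l s. c1 * d j + d1 ^ j * c j)),
      one = (1, \<lambda>j \<in> J l s. 0)\<rparr>"

definition hat_Phi ::
    "nat \<Rightarrow> nat \<Rightarrow> nat \<Rightarrow> 'a::field_char_0 \<Rightarrow> 'a \<Rightarrow> (nat \<Rightarrow> 'a) \<Rightarrow> 'a fps" where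
  "hat_Phi l s r \<delta> c1 c =
     lin c1 \<otimes>\<^bsub>subst_group s\<^esub>
       (tilde_Phi l r \<delta> (inverse c1 * c (l + 1)) \<otimes>\<^bsub>subst_group s\<^esub>
        bar_Phi l s (\<lambda>j. inverse c1 * c j))"

end

theory Submission
  imports Defs
begin

text \<open>
  A substitution \<open>\<Phi>\<close> solves the Aczel--Jabotinsky equation of \<open>H\<close> exactly when it maps the vector
  field \<open>H(x) d/dx\<close> to itself. More generally, let \<open>T\<close> transport \<open>V\<close> to \<open>W\<close> if \<open>W \<circ> T = T' V\<close> up to
  order \<open>s\<close>. Transporting substitutions compose and invert (\<open>transports_mult\<close>,
  \<open>transports_inv\<close>). Hence solutions form a group, and a \<open>T\<close> that transports the normal form
  \<open>x ^ (l+1) + \<delta> x ^ (2l+1)\<close> to \<open>H\<close> conjugates the solutions of the former onto those of the latter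
  (\<open>conj_iso\<close>). Part (ii) is therefore part (i) carried along an isomorphism, and everything else
  concerns the normal form.

  Solutions are rigid: if two of them with the same multiplier first differ at \<open>x ^ m\<close>, by \<open>d\<close>, then
  the equation at \<open>x ^ (m+l)\<close> says \<open>(l + 1) d = m d\<close>. So a solution up to order \<open>s\<close> is determined by
  its multiplier, which must be an \<open>l\<close>-th root of unity, by its coefficient at \<open>x ^ (l+1)\<close>, and by its
  last \<open>l\<close> coefficients, whose equations lie beyond order \<open>s\<close> (\<open>AJ_solution_rigid\<close>).

  All these data occur. The formal solutions with multiplier 1 have exponents congruent to 1 modulo
  \<open>l\<close> only. This makes the equations at the other exponents void, and at \<open>x ^ ((q+1) l + 1)\<close>
  the multinomial expansion of the powers turns the equation into the recursion of the universal
  polynomials (\<open>formal_sol_transports\<close>). Changing the last \<open>l\<close> coefficients of the identity changes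
  both sides of the equation only beyond order \<open>s\<close> (\<open>bar_sol\<close>), and rotations by \<open>l\<close>-th roots of
  unity preserve the normal form (\<open>lin_sol\<close>).

  The group law comes from one observation: series that agree with \<open>x\<close> up to orders \<open>a\<close> and \<open>b\<close>
  compose additively up to order \<open>a + b\<close> (\<open>fps_compose_near_id\<close>). It shows that the series
  \<open>bar_Phi\<close> compose additively and commute with the series \<open>tilde_Phi\<close>; for the latter, the coefficient
  at \<open>x ^ (l+1)\<close> is additive and rigidity does the rest. A rotation by \<open>d\<close> commutes with \<open>tilde_Phi\<close>
  and scales the parameter \<open>b j\<close> of \<open>bar_Phi\<close> by \<open>d ^ (j-1)\<close>. Collecting factors
  (\<open>hat_mult\<close>) gives the diamond operation.
\<close>

section \<open>Congruence of power series up to a given order\<close>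

definition fcong :: "enat \<Rightarrow> 'a::zero fps \<Rightarrow> 'a fps \<Rightarrow> bool" where
  "fcong s f g \<longleftrightarrow> (\<forall>j. enat j \<le> s \<longrightarrow> fps_nth f j = fps_nth g j)"

lemma fps_trunc_nth [simp]: "fps_nth (fps_trunc s f) j = (if enat j \<le> s then fps_nth f j else 0)"
  by (simp add: fps_trunc_def)

lemma fps_trunc_eq_iff: "fps_trunc s f = fps_trunc s g \<longleftrightarrow> fcong s f g"
  by (auto simp: fps_eq_iff fcong_def)

lemma fcong_refl [simp]: "fcong s f f"
  by (simp add: fcong_def)

lemma fcong_sym: "fcong s f g \<Longrightarrow> fcong s g f"
  by (simp add: fcong_def)

lemma fcong_trans [trans]: "fcong s f g \<Longrightarrow> fcong s g h \<Longrightarrow> fcong s f h"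
  by (simp add: fcong_def)

lemma fcong_trunc_left [simp]: "fcong s (fps_trunc s f) g \<longleftrightarrow> fcong s f g"
  and fcong_trunc_right [simp]: "fcong s f (fps_trunc s g) \<longleftrightarrow> fcong s f g"
  by (auto simp: fcong_def)

lemma fcong_mult:
  fixes f g :: "'a::comm_ring_1 fps"
  assumes "fcong s f f'" "fcong s g g'"
  shows "fcong s (f * g) (f' * g')"
  unfolding fcong_def
proof (intro allI impI)
  fix j assume j: "enat j \<le> s"
  have "enat i \<le> s" if "i \<le> j" for i
    using that j by (meson enat_ord_simps(1) order_trans)
  then show "fps_nth (f * g) j = fps_nth (f' * g') j"
    using assms unfolding fps_mult_nth fcong_def by (intro sum.cong) auto
qed

lemma fcong_power:
  fixes f g :: "'a::comm_ring_1 fps"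
  shows "fcong s f g \<Longrightarrow> fcong s (f ^ n) (g ^ n)"
  by (induction n) (auto intro: fcong_mult)

lemma fcong_compose:
  fixes f g :: "'a::comm_ring_1 fps"
  assumes "fcong s f f'" "fcong s g g'"
  shows "fcong s (f oo g) (f' oo g')"
  unfolding fcong_def
proof (intro allI impI)
  fix j assume j: "enat j \<le> s"
  have "enat i \<le> s" if "i \<le> j" for i
    using that j by (meson enat_ord_simps(1) order_trans)
  then show "fps_nth (f oo g) j = fps_nth (f' oo g') j"
    using assms(1) fcong_power[OF assms(2)] j
    unfolding fps_compose_nth fcong_def by (intro sum.cong) auto
qed

text \<open>
  Differentiation loses one order of precision; a factor without constant term restores it.
\<close>

lemma fcong_deriv_mult:
  fixes f g V :: "'a::comm_ring_1 fps"
  assumes "fcong s f g" "fps_nth V 0 = 0"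
  shows "fcong s (fps_deriv f * V) (fps_deriv g * V)"
  unfolding fcong_def
proof (intro allI impI)
  fix j assume j: "enat j \<le> s"
  have "fps_nth (fps_deriv f) i * fps_nth V (j - i) = fps_nth (fps_deriv g) i * fps_nth V (j - i)"
    if "i \<le> j" for i
  proof (cases "i = j")
    case False
    then have "enat (i + 1) \<le> s"
      using that j by (metis Suc_eq_plus1 Suc_leI enat_ord_simps(1) le_neq_implies_less order_trans)
    then show ?thesis
      using assms(1) by (simp add: fcong_def)
  qed (use assms in simp)
  then show "fps_nth (fps_deriv f * V) j = fps_nth (fps_deriv g * V) j"
    unfolding fps_mult_nth by (intro sum.cong) auto
qed


section \<open>The substitution groups\<close>

lemma subdegree_eq_1_iff:
  "subdegree f = 1 \<longleftrightarrow> fps_nth f 0 = 0 \<and> fps_nth f 1 \<noteq> 0"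
proof
  assume *: "subdegree f = 1"
  then have "f \<noteq> 0" by auto
  then show "fps_nth f 0 = 0 \<and> fps_nth f 1 \<noteq> 0"
    using * nth_subdegree_nonzero[of f] by (auto intro: nth_less_subdegree_zero)
qed (auto intro: subdegreeI)

lemma subst_carrier_iff:
  "f \<in> carrier (subst_group s) \<longleftrightarrow> fps_trunc s f = f \<and> fps_nth f 0 = 0 \<and> fps_nth f 1 \<noteq> 0"
  unfolding subst_group_def using subdegree_eq_1_iff[of f] by auto

lemma subst_mult: "f \<otimes>\<^bsub>subst_group s\<^esub> g = fps_trunc s (f oo g)"
  by (simp add: subst_group_def)

lemma subst_one: "\<one>\<^bsub>subst_group s\<^esub> = fps_X"
  by (simp add: subst_group_def)

lemma fps_compose_nth_1:
  fixes f g :: "'a::comm_ring_1 fps"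
  shows "fps_nth (f oo g) 1 = fps_nth f 1 * fps_nth g 1"
  by (simp add: fps_compose_nth)

lemma subst_carrier_cong_eq:
  "f \<in> carrier (subst_group s) \<Longrightarrow> g \<in> carrier (subst_group s) \<Longrightarrow> fcong s f g \<Longrightarrow> f = g"
  by (metis fps_trunc_eq_iff subst_carrier_iff)

lemma enat_1_le_trans: "1 \<le> s \<Longrightarrow> enat 1 \<le> s" "1 \<le> s \<Longrightarrow> enat (Suc 0) \<le> s"
  by (simp_all add: one_enat_def)

lemma subst_group_is_group:
  assumes s: "1 \<le> s"
  shows "group (subst_group s :: 'a::field_char_0 fps monoid)"
proof (rule groupI)
  note s' = enat_1_le_trans[OF s]
  fix x y z :: "'a fps"
  show "\<one>\<^bsub>subst_group s\<^esub> \<in> carrier (subst_group s :: 'a fps monoid)"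
    using s' by (auto simp: subst_carrier_iff subst_one fps_eq_iff)
  assume x: "x \<in> carrier (subst_group s)"
  show "\<one>\<^bsub>subst_group s\<^esub> \<otimes>\<^bsub>subst_group s\<^esub> x = x"
    using x by (simp add: subst_carrier_iff subst_one subst_mult)
  show "\<exists>y\<in>carrier (subst_group s). y \<otimes>\<^bsub>subst_group s\<^esub> x = \<one>\<^bsub>subst_group s\<^esub>"
  proof (intro bexI)
    have x': "fps_nth x 0 = 0" "fps_nth x 1 \<noteq> 0" using x by (auto simp: subst_carrier_iff)
    have "fps_inv x oo x = fps_X" using fps_inv[OF x'] .
    moreover have "fcong s (fps_trunc s (fps_inv x) oo x) (fps_inv x oo x)"
      by (rule fcong_compose) auto
    ultimately have "fcong s (fps_trunc s (fps_inv x) oo x) fps_X" by simp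
    then show "fps_trunc s (fps_inv x) \<otimes>\<^bsub>subst_group s\<^esub> x = \<one>\<^bsub>subst_group s\<^esub>"
      unfolding subst_mult subst_one fps_trunc_eq_iff[symmetric]
      using s' by (auto simp: fps_eq_iff)
    have "fps_nth (fps_inv x) 1 * fps_nth x 1 = 1"
      using \<open>fps_inv x oo x = fps_X\<close> fps_compose_nth_1[of "fps_inv x" x] by simp
    then have "fps_nth (fps_inv x) 1 \<noteq> 0" by auto
    moreover have "fps_nth (fps_inv x) 0 = 0" by (simp add: fps_inv_def)
    ultimately show "fps_trunc s (fps_inv x) \<in> carrier (subst_group s)"
      using s' by (auto simp: subst_carrier_iff fps_eq_iff)
  qed
  assume y: "y \<in> carrier (subst_group s)"
  show "x \<otimes>\<^bsub>subst_group s\<^esub> y \<in> carrier (subst_group s)"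
    using x y s' fps_compose_nth_1[of x y]
    by (auto simp: subst_carrier_iff subst_mult fps_eq_iff)
  assume z: "z \<in> carrier (subst_group s)"
  have "fcong s (fps_trunc s (x oo y) oo z) ((x oo y) oo z)"
    by (rule fcong_compose) auto
  also have "(x oo y) oo z = x oo (y oo z)"
    using y z by (simp add: fps_compose_assoc subst_carrier_iff)
  also have "fcong s (x oo (y oo z)) (x oo fps_trunc s (y oo z))"
    by (rule fcong_compose) auto
  finally show "x \<otimes>\<^bsub>subst_group s\<^esub> y \<otimes>\<^bsub>subst_group s\<^esub> z = x \<otimes>\<^bsub>subst_group s\<^esub> (y \<otimes>\<^bsub>subst_group s\<^esub> z)"
    by (simp add: subst_mult fps_trunc_eq_iff)
qed


section \<open>Substitutions as maps between vector fields\<close>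

text \<open>
  The relation \<open>W \<circ> T = T' V\<close> says that \<open>T\<close> carries the vector field \<open>V d/dx\<close> to \<open>W d/dx\<close>. It covers
  both the Aczel--Jabotinsky equation (\<open>V = W\<close>) and the change of equation induced by a substitution.
\<close>

definition transports :: "enat \<Rightarrow> 'a::field_char_0 fps \<Rightarrow> 'a fps \<Rightarrow> 'a fps \<Rightarrow> bool" where
  "transports s T V W \<longleftrightarrow> fcong s (W oo T) (fps_deriv T * V)"

lemma AJ_sols_iff: "\<Phi> \<in> AJ_sols s H \<longleftrightarrow> \<Phi> \<in> carrier (subst_group s) \<and> transports s \<Phi> H H"
  by (simp add: AJ_sols_def transports_def fps_trunc_eq_iff)

lemma transports_id: "transports s fps_X V V"
  by (simp add: transports_def)

text \<open>
  Only the truncation of \<open>T\<close> matters, although its derivative enters: the vector field \<open>V\<close> vanishes at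
  the origin and so makes up for the order lost by differentiating.
\<close>

lemma transports_cong:
  assumes "fcong s T T'" "fps_nth V 0 = 0" "transports s T V W"
  shows "transports s T' V W"
proof -
  have "fcong s (W oo T') (W oo T)"
    by (rule fcong_compose) (use assms in \<open>auto intro: fcong_sym\<close>)
  also have "fcong s (W oo T) (fps_deriv T * V)"
    using assms by (simp add: transports_def)
  also have "fcong s (fps_deriv T * V) (fps_deriv T' * V)"
    by (rule fcong_deriv_mult) fact+
  finally show ?thesis by (simp add: transports_def)
qed

text \<open>
  The chain rule.
\<close>

lemma transports_compose:
  assumes "transports s T V W" "transports s R W Z" "fps_nth T 0 = 0" "fps_nth R 0 = 0"
  shows "transports s (R oo T) V Z"
proof -
  have "Z oo (R oo T) = (Z oo R) oo T"
    using assms by (simp add: fps_compose_assoc)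
  also have "fcong s \<dots> ((fps_deriv R * W) oo T)"
    using assms by (intro fcong_compose) (auto simp: transports_def)
  also have "(fps_deriv R * W) oo T = (fps_deriv R oo T) * (W oo T)"
    using assms by (simp add: fps_compose_mult_distrib)
  also have "fcong s \<dots> ((fps_deriv R oo T) * (fps_deriv T * V))"
    using assms by (intro fcong_mult) (auto simp: transports_def)
  also have "(fps_deriv R oo T) * (fps_deriv T * V) = fps_deriv (R oo T) * V"
    using assms by (simp add: fps_compose_deriv mult_ac)
  finally show ?thesis by (simp add: transports_def)
qed

text \<open>
  Substituting \<open>S\<close> into \<open>W \<circ> T = T' V\<close> and multiplying by \<open>S'\<close> cancels the factor \<open>T' \<circ> S\<close>, because
  \<open>(T' \<circ> S) S'\<close> is the derivative of \<open>T \<circ> S = x\<close>.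
\<close>

lemma transports_inverse:
  assumes "transports s T V W" "fps_nth T 0 = 0" "fps_nth S 0 = 0" "fps_nth V 0 = 0"
    and TS: "fcong s (T oo S) fps_X"
  shows "transports s S W V"
proof -
  have "fcong s (W oo fps_X) (W oo (T oo S))"
    by (rule fcong_compose) (use TS in \<open>auto intro: fcong_sym\<close>)
  also have "W oo (T oo S) = (W oo T) oo S"
    using assms by (simp add: fps_compose_assoc)
  also have "fcong s \<dots> ((fps_deriv T * V) oo S)"
    using assms by (intro fcong_compose) (auto simp: transports_def)
  also have "(fps_deriv T * V) oo S = (fps_deriv T oo S) * (V oo S)"
    using assms by (simp add: fps_compose_mult_distrib)
  finally have "fcong s W ((fps_deriv T oo S) * (V oo S))" by simp
  then have "fcong s (fps_deriv S * W) (fps_deriv S * ((fps_deriv T oo S) * (V oo S)))"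
    by (intro fcong_mult) auto
  also have "\<dots> = fps_deriv (T oo S) * (V oo S)"
    using assms by (simp add: fps_compose_deriv mult_ac)
  also have "fcong s \<dots> (fps_deriv fps_X * (V oo S))"
    by (rule fcong_deriv_mult) (use assms in auto)
  finally show ?thesis by (simp add: transports_def fcong_sym)
qed

lemma transports_mult:
  assumes "transports s T V W" "transports s R W Z" "fps_nth V 0 = 0"
    and "T \<in> carrier (subst_group s)" "R \<in> carrier (subst_group s)"
  shows "transports s (R \<otimes>\<^bsub>subst_group s\<^esub> T) V Z"
proof (rule transports_cong[OF _ assms(3)])
  show "transports s (R oo T) V Z"
    using assms by (intro transports_compose[of s T V W]) (auto simp: subst_carrier_iff)
qed (simp add: subst_mult)

lemma transports_inv:
  assumes "1 \<le> s" "transports s T V W" "fps_nth V 0 = 0" "T \<in> carrier (subst_group s)"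
  shows "transports s (inv\<^bsub>subst_group s\<^esub> T) W V"
proof -
  interpret group "subst_group s :: 'a fps monoid" by (rule subst_group_is_group) fact
  have "fcong s (T oo inv\<^bsub>subst_group s\<^esub> T) fps_X"
    using r_inv[OF assms(4)] fps_trunc_eq_iff fcong_trunc_left by (metis fcong_refl subst_mult subst_one)
  then show ?thesis
    using assms inv_closed[OF assms(4)] by (intro transports_inverse[of s T V W]) (auto simp: subst_carrier_iff)
qed

lemma AJ_subgroup:
  assumes "1 \<le> s" "fps_nth H 0 = 0"
  shows "subgroup (AJ_sols s H) (subst_group s)"
proof -
  interpret group "subst_group s :: 'a fps monoid" by (rule subst_group_is_group) fact
  show ?thesis
  proof (rule subgroupI)
    show "AJ_sols s H \<noteq> {}"
      using one_closed by (auto simp: AJ_sols_iff subst_one intro!: exI[of _ fps_X] transports_id)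
  qed (use assms in \<open>auto simp: AJ_sols_iff intro: transports_mult transports_inv\<close>)
qed

lemma AJ_group_simps:
  "carrier (AJ_group s H) = AJ_sols s H"
  "x \<otimes>\<^bsub>AJ_group s H\<^esub> y = x \<otimes>\<^bsub>subst_group s\<^esub> y"
  "\<one>\<^bsub>AJ_group s H\<^esub> = \<one>\<^bsub>subst_group s\<^esub>"
  by (simp_all add: AJ_group_def)

lemma AJ_group_is_group:
  assumes "1 \<le> s" "fps_nth H 0 = 0"
  shows "group (AJ_group s H)"
  unfolding AJ_group_def
  by (rule subgroup.subgroup_is_group[OF AJ_subgroup[OF assms] subst_group_is_group[OF assms(1)]])

text \<open>
  The constant term of \<open>T'\<close> is nonzero, so the division by \<open>T'\<close> can be undone.
\<close>

lemma AJ_transforms_iff_transports: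
  assumes "fps_nth T 1 \<noteq> 0" "fps_trunc s Ht = Ht"
  shows "AJ_transforms s T H Ht \<longleftrightarrow> transports s T Ht H"
proof -
  have unit: "fps_deriv T * inverse (fps_deriv T) = 1"
    using assms by (intro inverse_mult_eq_1') auto
  have "AJ_transforms s T H Ht \<longleftrightarrow> fcong s Ht (inverse (fps_deriv T) * (H oo T))"
    using assms fps_trunc_eq_iff[of s Ht "inverse (fps_deriv T) * (H oo T)"]
    by (auto simp: AJ_transforms_def)
  also have "\<dots> \<longleftrightarrow> transports s T Ht H"
  proof
    assume "fcong s Ht (inverse (fps_deriv T) * (H oo T))"
    then have "fcong s (fps_deriv T * Ht) (fps_deriv T * (inverse (fps_deriv T) * (H oo T)))"
      by (rule fcong_mult[OF fcong_refl])
    then show "transports s T Ht H"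
      using unit by (simp add: transports_def fcong_sym flip: mult.assoc)
  next
    assume "transports s T Ht H"
    then have "fcong s (inverse (fps_deriv T) * (H oo T)) (inverse (fps_deriv T) * (fps_deriv T * Ht))"
      unfolding transports_def by (rule fcong_mult[OF fcong_refl])
    moreover have "inverse (fps_deriv T) * (fps_deriv T * Ht) = Ht"
      using unit by (simp add: mult_ac flip: mult.assoc)
    ultimately show "fcong s Ht (inverse (fps_deriv T) * (H oo T))"
      by (simp add: fcong_sym)
  qed
  finally show ?thesis .
qed


section \<open>Rigidity of solutions\<close>

text \<open>
  In a product of \<open>k + 1\<close> factors, a change of one factor from \<open>x ^ m\<close> on is pushed up to
  \<open>x ^ (m+k)\<close>, since each of the other \<open>k\<close> factors contributes at least one \<open>x\<close>. The constant term
  of the cofactor records how the power depends on the coefficient at \<open>x ^ m\<close>.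
\<close>

lemma fps_power_diff_factor:
  fixes f g :: "'a::idom fps"
  assumes f0: "fps_nth f 0 = 0" and m: "2 \<le> m" and eq: "\<And>j. j < m \<Longrightarrow> fps_nth f j = fps_nth g j"
  shows "\<exists>E. f ^ Suc k - g ^ Suc k = fps_X ^ (m + k) * E \<and>
             fps_nth E 0 = of_nat (Suc k) * fps_nth f 1 ^ k * (fps_nth f m - fps_nth g m)"
proof (induction k)
  have fg: "f - g = fps_X ^ m * fps_shift m (f - g)"
    by (rule fps_ext) (simp add: fps_X_power_mult_nth eq)
  {
    case 0
    show ?case using fg by (intro exI[of _ "fps_shift m (f - g)"]) simp
  next
    case (Suc k)
    then obtain E where E: "f ^ Suc k - g ^ Suc k = fps_X ^ (m + k) * E"
      "fps_nth E 0 = of_nat (Suc k) * fps_nth f 1 ^ k * (fps_nth f m - fps_nth g m)"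
      by blast
    have f: "f = fps_X * fps_shift 1 f" using f0
      by (intro fps_ext) simp
    have g0: "fps_nth g 0 = 0" "fps_nth g 1 = fps_nth f 1" using eq[of 0] eq[of 1] f0 m by auto
    have g: "g = fps_X * fps_shift 1 g" using g0
      by (intro fps_ext) simp
    have "g ^ Suc k = fps_X ^ Suc k * fps_shift 1 g ^ Suc k"
      by (metis g power_mult_distrib)
    moreover have "f ^ Suc (Suc k) - g ^ Suc (Suc k) = f * (f ^ Suc k - g ^ Suc k) + (f - g) * g ^ Suc k"
      by (simp add: algebra_simps)
    ultimately have "f ^ Suc (Suc k) - g ^ Suc (Suc k) =
        (fps_X * fps_shift 1 f) * (fps_X ^ (m + k) * E)
        + (fps_X ^ m * fps_shift m (f - g)) * (fps_X ^ Suc k * fps_shift 1 g ^ Suc k)"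
      using E(1) f fg by metis
    also have "\<dots> = fps_X ^ (m + Suc k) * (fps_shift 1 f * E + fps_shift m (f - g) * fps_shift 1 g ^ Suc k)"
      by (simp add: algebra_simps power_add)
    finally show ?case
    proof (intro exI conjI)
      have "fps_nth (fps_shift 1 f * E + fps_shift m (f - g) * fps_shift 1 g ^ Suc k) 0
          = fps_nth f 1 * fps_nth E 0 + (fps_nth f m - fps_nth g m) * fps_nth f 1 ^ Suc k"
        using g0 by (simp add: fps_power_zeroth)
      then show "fps_nth (fps_shift 1 f * E + fps_shift m (f - g) * fps_shift 1 g ^ Suc k) 0
          = of_nat (Suc (Suc k)) * fps_nth f 1 ^ Suc k * (fps_nth f m - fps_nth g m)"
        unfolding E(2) by (simp add: algebra_simps)
    qed
  }
qed

lemma fps_power_nth_agree: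
  fixes f g :: "'a::idom fps"
  assumes "fps_nth f 0 = 0" "2 \<le> m" "\<And>j. j < m \<Longrightarrow> fps_nth f j = fps_nth g j" "j < m + k"
  shows "fps_nth (f ^ Suc k) j = fps_nth (g ^ Suc k) j"
proof -
  obtain E where "f ^ Suc k - g ^ Suc k = fps_X ^ (m + k) * E"
    using fps_power_diff_factor[OF assms(1-3)] by blast
  then have "fps_nth (f ^ Suc k - g ^ Suc k) j = 0"
    using assms(4) by (simp add: fps_X_power_mult_nth)
  then show ?thesis by simp
qed

lemma fps_power_nth_first_diff:
  fixes f g :: "'a::idom fps"
  assumes "fps_nth f 0 = 0" "2 \<le> m" "\<And>j. j < m \<Longrightarrow> fps_nth f j = fps_nth g j"
  shows "fps_nth (f ^ Suc k) (m + k) =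
    fps_nth (g ^ Suc k) (m + k) + of_nat (Suc k) * fps_nth f 1 ^ k * (fps_nth f m - fps_nth g m)"
proof -
  obtain E where "f ^ Suc k - g ^ Suc k = fps_X ^ (m + k) * E"
    "fps_nth E 0 = of_nat (Suc k) * fps_nth f 1 ^ k * (fps_nth f m - fps_nth g m)"
    using fps_power_diff_factor[OF assms(1-3)] by blast
  then have "fps_nth (f ^ Suc k - g ^ Suc k) (m + k)
      = of_nat (Suc k) * fps_nth f 1 ^ k * (fps_nth f m - fps_nth g m)"
    by (simp add: fps_X_power_mult_nth)
  then show ?thesis by (simp add: algebra_simps)
qed

text \<open>
  At the first differing coefficient, at \<open>x ^ m\<close>, the left side of the equation varies at \<open>x ^ (m+l)\<close>
  by \<open>l + 1\<close> times the difference and the right side by \<open>m\<close> times it. Hence only \<open>m = l + 1\<close>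
  escapes, besides those \<open>m\<close> whose equation lies beyond order \<open>s\<close>.
\<close>

lemma AJ_solution_rigid:
  fixes H \<Phi> \<Psi> :: "'a::field_char_0 fps"
  assumes H: "\<And>i. i \<le> l \<Longrightarrow> fps_nth H i = 0" "fps_nth H (l + 1) = 1"
    and sol: "transports s \<Phi> H H" "transports s \<Psi> H H"
    and start: "fps_nth \<Phi> 0 = 0" "fps_nth \<Psi> 0 = 0" "fps_nth \<Phi> 1 = fps_nth \<Psi> 1"
    and root: "fps_nth \<Phi> 1 ^ l = 1"
    and free: "fps_nth \<Phi> (l + 1) = fps_nth \<Psi> (l + 1)"
  shows "enat (m + l) \<le> s \<Longrightarrow> fps_nth \<Phi> m = fps_nth \<Psi> m"
proof (induction m rule: less_induct)
  case (less m)
  consider "m = 0" | "m = 1" | "m = l + 1" | "2 \<le> m" "m \<noteq> l + 1" by linarith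
  then show ?case
  proof cases
    case 4
    have agree: "fps_nth \<Phi> j = fps_nth \<Psi> j" if "j < m" for j
      using that less.prems
      by (intro less.IH) (auto intro: order_trans[of _ "enat (m + l)"])
    define d where "d = fps_nth \<Phi> m - fps_nth \<Psi> m"
    have lhs: "fps_nth (H oo \<Phi>) (m + l) = fps_nth (H oo \<Psi>) (m + l) + of_nat (l + 1) * d"
    proof -
      have each: "fps_nth H i * fps_nth (\<Phi> ^ i) (m + l)
          = fps_nth H i * fps_nth (\<Psi> ^ i) (m + l) + (if i = l + 1 then of_nat (l + 1) * d else 0)" for i
      proof -
        consider "i \<le> l" | "i = l + 1" | k where "i = Suc k" "l < k"
          by (metis Suc_eq_plus1 linorder_neqE_nat linorder_not_less not_less_eq old.nat.exhaust zero_le)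
        then show ?thesis
        proof cases
          case 2
          then show ?thesis
            using fps_power_nth_first_diff[OF start(1) 4(1) agree, of l] root H(2)
            by (simp add: d_def)
        next
          case 3
          then show ?thesis
            using fps_power_nth_agree[OF start(1) 4(1) agree, of "m + l" k] by simp
        qed (use H in simp)
      qed
      show ?thesis
        unfolding fps_compose_nth each using 4 by (simp add: sum.distrib)
    qed
    have rhs: "fps_nth (fps_deriv \<Phi> * H) (m + l) = fps_nth (fps_deriv \<Psi> * H) (m + l) + of_nat m * d"
    proof -
      have each: "fps_nth (fps_deriv \<Phi>) i * fps_nth H (m + l - i)
          = fps_nth (fps_deriv \<Psi>) i * fps_nth H (m + l - i) + (if i = m - 1 then of_nat m * d else 0)" for i
      proof -
        consider "i + 1 < m" | "i = m - 1" | "m \<le> i" by linarith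
        then show ?thesis
        proof cases
          case 1
          then show ?thesis using agree[of "i + 1"] by simp
        next
          case 2
          then have "m + l - i = l + 1" "i + 1 = m" using 4 by auto
          then show ?thesis using H(2) 2 by (simp add: d_def algebra_simps)
        next
          case 3
          then show ?thesis using H(1)[of "m + l - i"] 4 by simp
        qed
      qed
      show ?thesis
        unfolding fps_mult_nth each using 4 by (simp add: sum.distrib)
    qed
    have "of_nat (l + 1) * d = of_nat m * d"
      using lhs rhs sol less.prems unfolding transports_def fcong_def by (metis add_left_cancel)
    then have "d = 0"
      using 4 of_nat_eq_iff[of "l + 1" m, where 'a = 'a] by (metis mult_cancel_right)
    then show ?thesis by (simp add: d_def)
  qed (use start free in auto)
qed


section \<open>Coefficients of powers of a series\<close>

text \<open>
  The exponent vectors of the monomials of degree \<open>i\<close> in variables indexed by \<open>A\<close>.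
\<close>

definition compositions :: "'i set \<Rightarrow> nat \<Rightarrow> ('i \<Rightarrow> nat) set" where
  "compositions A i = {u \<in> A \<rightarrow>\<^sub>E {0..i}. sum u A = i}"

lemma finite_compositions: "finite A \<Longrightarrow> finite (compositions A i)"
  unfolding compositions_def by (rule finite_subset[OF _ finite_PiE[of A "\<lambda>_. {0..i}"]]) auto

lemma compositions_iff:
  assumes "finite A"
  shows "u \<in> compositions A i \<longleftrightarrow> u \<in> extensional A \<and> sum u A = i"
  using assms member_le_sum[of _ A u] by (auto simp: compositions_def PiE_iff)

text \<open>
  The multinomial theorem, by splitting off one summand with the binomial theorem. The coefficients
  are written as quotients of factorials in the field, so that the factors for the split-off summand
  multiply directly.
\<close>

lemma multinomial_fps:
  fixes y :: "'i \<Rightarrow> 'a::field_char_0 fps"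
  assumes "finite A"
  shows "(\<Sum>j\<in>A. y j) ^ i =
    (\<Sum>u\<in>compositions A i. fps_const (fact i / (\<Prod>j\<in>A. fact (u j))) * (\<Prod>j\<in>A. y j ^ u j))"
  using assms
proof (induction A arbitrary: i rule: finite_induct)
  case empty
  then show ?case by (cases i) (auto simp: compositions_def)
next
  case (insert a A)
  note fin = insert.hyps(1)
  have coef: "of_nat (i choose k) * Y * (fps_const (fact (i - k) / P) * Z)
      = fps_const (fact i / (fact k * P)) * (Y * Z)"
    if "k \<le> i" for k P and Y Z :: "'a fps"
  proof -
    have "of_nat (i choose k) * fps_const (fact (i - k) / P) = fps_const (fact i / (fact k * P))"
      using that by (simp add: fps_of_nat[symmetric] binomial_fact)
    then show ?thesis by (metis mult.assoc mult.left_commute)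
  qed
  have "(\<Sum>j\<in>insert a A. y j) ^ i = (y a + (\<Sum>j\<in>A. y j)) ^ i"
    using insert.hyps by simp
  also have "\<dots> = (\<Sum>k\<le>i. of_nat (i choose k) * y a ^ k * (\<Sum>j\<in>A. y j) ^ (i - k))"
    by (rule binomial_ring)
  also have "\<dots> = (\<Sum>k\<le>i. \<Sum>u\<in>compositions A (i - k).
      fps_const (fact i / (fact k * (\<Prod>j\<in>A. fact (u j)))) * (y a ^ k * (\<Prod>j\<in>A. y j ^ u j)))"
    unfolding insert.IH sum_distrib_left
    by (intro sum.cong refl coef) auto
  also have "\<dots> = (\<Sum>(k, u)\<in>Sigma {..i} (\<lambda>k. compositions A (i - k)).
      fps_const (fact i / (fact k * (\<Prod>j\<in>A. fact (u j)))) * (y a ^ k * (\<Prod>j\<in>A. y j ^ u j)))"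
    using finite_compositions[OF fin] by (subst sum.Sigma) auto
  also have "\<dots> = (\<Sum>v\<in>compositions (insert a A) i.
      fps_const (fact i / (\<Prod>j\<in>insert a A. fact (v j))) * (\<Prod>j\<in>insert a A. y j ^ v j))"
  proof (rule sum.reindex_bij_witness
      [where i = "\<lambda>v. (v a, restrict v A)" and j = "\<lambda>(k, u). u(a := k)"])
    fix v assume v: "v \<in> compositions (insert a A) i"
    then have v': "v \<in> extensional (insert a A)" "v a + sum v A = i"
      using insert.hyps compositions_iff[of "insert a A" v i] by auto
    show "(case (v a, restrict v A) of (k, u) \<Rightarrow> u(a := k)) = v"
      using v' insert.hyps by (auto simp: fun_eq_iff extensional_def)
    show "(v a, restrict v A) \<in> Sigma {..i} (\<lambda>k. compositions A (i - k))"
      using v' by (auto simp: compositions_iff[OF fin])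
  next
    fix p assume p: "p \<in> Sigma {..i} (\<lambda>k. compositions A (i - k))"
    obtain k u where ku: "p = (k, u)" by (cases p)
    have u: "u \<in> extensional A" "sum u A = i - k" "k \<le> i"
      using p by (auto simp: ku compositions_iff[OF fin])
    have upd: "(u(a := k)) j = u j" if "j \<in> A" for j using that insert.hyps by auto
    have sums: "sum (u(a := k)) A = sum u A" "(\<Prod>j\<in>A. fact ((u(a := k)) j)) = (\<Prod>j\<in>A. fact (u j) :: 'a)"
      "(\<Prod>j\<in>A. y j ^ ((u(a := k)) j)) = (\<Prod>j\<in>A. y j ^ u j)"
      by (intro sum.cong prod.cong refl; simp only: upd)+
    show "((case p of (k, u) \<Rightarrow> u(a := k)) a, restrict (case p of (k, u) \<Rightarrow> u(a := k)) A) = p"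
      using u insert.hyps by (auto simp: ku fun_eq_iff extensional_def)
    have "u(a := k) \<in> extensional (insert a A)" using u by (auto simp: extensional_def)
    then show "(case p of (k, u) \<Rightarrow> u(a := k)) \<in> compositions (insert a A) i"
      using u insert.hyps sums by (simp add: ku compositions_iff)
    show "fps_const (fact i / (\<Prod>j\<in>insert a A. fact ((case p of (k, u) \<Rightarrow> u(a := k)) j))) *
        (\<Prod>j\<in>insert a A. y j ^ (case p of (k, u) \<Rightarrow> u(a := k)) j) =
        (case p of (k, u) \<Rightarrow> fps_const (fact i / (fact k * (\<Prod>j\<in>A. fact (u j)))) *
          (y a ^ k * (\<Prod>j\<in>A. y j ^ u j)))"
      using insert.hyps sums by (simp add: ku)
  qed
  finally show ?case .
qed

lemma of_rat_fact: "of_rat (fact n) = (fact n :: 'a::field_char_0)"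
  by (metis of_nat_fact of_rat_of_nat_eq)

lemma of_rat_prod: "of_rat (\<Prod>j\<in>A. f j) = (\<Prod>j\<in>A. of_rat (f j) :: 'a::field_char_0)"
  by (induction A rule: infinite_finite_induct) (auto simp: of_rat_mult)

lemma fps_const_prod: "fps_const (\<Prod>j\<in>A. f j) = (\<Prod>j\<in>A. fps_const (f j) :: 'a::comm_ring_1 fps)"
  by (induction A rule: infinite_finite_induct) (auto simp flip: fps_const_mult)

text \<open>
  Only the first \<open>n\<close> coefficients of \<open>f\<close> influence the coefficient at \<open>x ^ n\<close>, so the multinomial
  theorem applies to a polynomial; the second condition in \<open>U\<close> selects the monomials of degree \<open>n\<close>.
\<close>

lemma fps_power_nth_U:
  fixes f :: "'a::field_char_0 fps"
  assumes f0: "fps_nth f 0 = 0"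
  shows "fps_nth (f ^ i) n = (\<Sum>u\<in>U n i. of_rat (B n i u) * (\<Prod>j = 1..n. fps_nth f j ^ u j))"
proof -
  define y where "y j = fps_const (fps_nth f j) * fps_X ^ j" for j
  have "fps_nth (\<Sum>j = 1..n. y j) k = fps_nth f k" if "k \<le> n" for k
  proof -
    have "fps_nth (\<Sum>j = 1..n. y j) k = (\<Sum>j = 1..n. if k = j then fps_nth f j else 0)"
      unfolding y_def fps_sum_nth by (intro sum.cong) auto
    then show ?thesis using that f0 by (cases "k = 0") auto
  qed
  then have "fcong (enat n) f (\<Sum>j = 1..n. y j)"
    by (simp add: fcong_def)
  then have "fps_nth (f ^ i) n = fps_nth ((\<Sum>j = 1..n. y j) ^ i) n"
    using fcong_power[of "enat n" f _ i] by (simp add: fcong_def)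
  also have "\<dots> = (\<Sum>u\<in>compositions {1..n} i.
      fact i / (\<Prod>j = 1..n. fact (u j)) * fps_nth (\<Prod>j = 1..n. y j ^ u j) n)"
    by (simp add: multinomial_fps fps_sum_nth)
  also have "\<dots> = (\<Sum>u\<in>compositions {1..n} i. if (\<Sum>j = 1..n. j * u j) = n
      then of_rat (B n i u) * (\<Prod>j = 1..n. fps_nth f j ^ u j) else 0)"
  proof (intro sum.cong refl)
    fix u :: "nat \<Rightarrow> nat"
    have "(\<Prod>j = 1..n. y j ^ u j) = fps_const (\<Prod>j = 1..n. fps_nth f j ^ u j) * fps_X ^ (\<Sum>j = 1..n. j * u j)"
      by (simp add: y_def power_mult_distrib prod.distrib power_sum fps_const_prod flip: power_mult)
    then have "fps_nth (\<Prod>j = 1..n. y j ^ u j) n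
        = (if (\<Sum>j = 1..n. j * u j) = n then \<Prod>j = 1..n. fps_nth f j ^ u j else 0)"
      by auto
    then show "fact i / (\<Prod>j = 1..n. fact (u j)) * fps_nth (\<Prod>j = 1..n. y j ^ u j) n =
        (if (\<Sum>j = 1..n. j * u j) = n
         then of_rat (B n i u) * (\<Prod>j = 1..n. fps_nth f j ^ u j) else 0)"
      by (simp add: B_def of_rat_divide of_rat_fact of_rat_prod)
  qed
  also have "\<dots> = (\<Sum>u\<in>U n i. of_rat (B n i u) * (\<Prod>j = 1..n. fps_nth f j ^ u j))"
    using finite_compositions[of "{1..n}" i]
    by (subst sum.inter_filter[symmetric]) (auto simp: U_def compositions_def intro!: sum.cong)
  finally show ?thesis .
qed


section \<open>Evaluating the universal polynomials\<close>

text \<open>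
  Applied twice, once for each variable, this makes \<open>eval_yt\<close> a ring homomorphism.
\<close>

lemma poly_map_poly_hom:
  fixes h :: "'b::comm_ring_1 \<Rightarrow> 'c::comm_ring_1"
  assumes h0: "h 0 = 0" and hadd: "\<And>x y. h (x + y) = h x + h y"
    and hmult: "\<And>x y. h (x * y) = h x * h y"
  shows poly_map_poly_add: "poly (map_poly h (p + q)) a = poly (map_poly h p) a + poly (map_poly h q) a"
    and poly_map_poly_mult: "poly (map_poly h (p * q)) a = poly (map_poly h p) a * poly (map_poly h q) a"
proof -
  have cons: "poly (map_poly h (pCons c p)) a = h c + a * poly (map_poly h p) a" for c p
    using h0 by (cases "pCons c p = 0") (auto simp: map_poly_pCons)
  have add: "poly (map_poly h (p + q)) a = poly (map_poly h p) a + poly (map_poly h q) a" for p q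
    by (induction p q rule: poly_induct2) (simp_all add: cons hadd algebra_simps)
  have smult: "poly (map_poly h (smult c q)) a = h c * poly (map_poly h q) a" for c q
    by (induction q) (simp_all add: cons hmult algebra_simps)
  have "poly (map_poly h (p * q)) a = poly (map_poly h p) a * poly (map_poly h q) a" for p q
    by (induction p) (simp_all add: cons add smult h0 algebra_simps)
  then show "poly (map_poly h (p * q)) a = poly (map_poly h p) a * poly (map_poly h q) a" .
  show "poly (map_poly h (p + q)) a = poly (map_poly h p) a + poly (map_poly h q) a"
    by (fact add)
qed

lemma eval_yt_add: "eval_yt (P + R) a b = eval_yt P a b + eval_yt R a b"
  and eval_yt_mult: "eval_yt (P * R) a b = eval_yt P a b * eval_yt R a b"
proof -
  let ?g = "\<lambda>p. poly (map_poly of_rat p) a"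
  have g: "?g (p + q) = ?g p + ?g q" "?g (p * q) = ?g p * ?g q" for p q
    by (rule poly_map_poly_hom; simp add: of_rat_add of_rat_mult)+
  show "eval_yt (P + R) a b = eval_yt P a b + eval_yt R a b"
    "eval_yt (P * R) a b = eval_yt P a b * eval_yt R a b"
    unfolding eval_yt_def by (rule poly_map_poly_hom; simp add: g)+
qed

lemma eval_yt_pconst: "eval_yt (pconst q) a b = of_rat q"
  by (cases "q = 0") (simp_all add: eval_yt_def map_poly_pCons)

lemma eval_yt_0: "eval_yt 0 a b = 0"
  by (simp add: eval_yt_def)

lemma eval_yt_1: "eval_yt 1 a b = 1"
  using eval_yt_pconst[of 1 a b] by (simp add: one_pCons)

lemma eval_yt_of_nat: "eval_yt (of_nat n) a b = of_nat n"
  by (induction n) (simp_all add: eval_yt_0 eval_yt_1 eval_yt_add)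

lemma eval_yt_diff: "eval_yt (P - R) a b = eval_yt P a b - eval_yt R a b"
  using eval_yt_add[of "P - R" R a b] by simp

lemma eval_yt_sum: "eval_yt (\<Sum>x\<in>S. P x) a b = (\<Sum>x\<in>S. eval_yt (P x) a b)"
  by (induction S rule: infinite_finite_induct) (simp_all add: eval_yt_0 eval_yt_add)

lemma eval_yt_power: "eval_yt (P ^ n) a b = eval_yt P a b ^ n"
  by (induction n) (simp_all add: eval_yt_1 eval_yt_mult)

lemma eval_yt_prod: "eval_yt (\<Prod>x\<in>S. P x) a b = (\<Prod>x\<in>S. eval_yt (P x) a b)"
  by (induction S rule: infinite_finite_induct) (simp_all add: eval_yt_1 eval_yt_mult)

lemma eval_yt_y: "eval_yt pvar_y a b = a"
  by (simp add: eval_yt_def map_poly_pCons)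

lemma eval_yt_t: "eval_yt pvar_t a b = b"
  by (simp add: eval_yt_def map_poly_pCons one_pCons)

lemma eval_Q_1: "eval_yt (Q l 1) c \<delta> = c"
  by (subst Q.simps) (simp add: eval_yt_y)

lemma eval_Q_rec:
  assumes "2 \<le> q" "n = (q + 1) * l + 1"
  shows "eval_yt (Q l q) c \<delta> = 1 / of_nat ((q - 1) * l) *
    ((\<Sum>u\<in>U_check l n. of_rat (B n (l + 1) u) * (\<Prod>j = 1..q - 1. eval_yt (Q l j) c \<delta> ^ u (j * l + 1)))
     + \<delta> * (\<Sum>u\<in>U_res l n (2 * l + 1).
         of_rat (B n (2 * l + 1) u) * (\<Prod>j = 1..q - 1. eval_yt (Q l j) c \<delta> ^ u (j * l + 1)))
     - \<delta> * of_nat ((q - 1) * l + 1) * eval_yt (Q l (q - 1)) c \<delta>)"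
proof -
  have "of_rat (1 / of_nat k) = (1 / of_nat k :: 'a)" for k
    by (simp add: of_rat_divide)
  moreover have "Q l q = pconst (1 / of_nat ((q - 1) * l)) *
         ((\<Sum>u \<in> U_check l n. pconst (B n (l + 1) u) * (\<Prod>j = 1..q - 1. Q l j ^ u (j * l + 1)))
          + pvar_t * (\<Sum>u \<in> U_res l n (2 * l + 1).
              pconst (B n (2 * l + 1) u) * (\<Prod>j = 1..q - 1. Q l j ^ u (j * l + 1)))
          - pvar_t * of_nat ((q - 1) * l + 1) * Q l (q - 1))"
    using assms by (subst Q.simps) (simp add: Let_def)
  ultimately show ?thesis
    by (simp only: eval_yt_mult eval_yt_diff eval_yt_add eval_yt_sum eval_yt_prod eval_yt_power
        eval_yt_t eval_yt_of_nat eval_yt_pconst)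
qed


section \<open>Formal solutions of the normal form\<close>

text \<open>
  The full, untruncated series of which the series \<open>tilde_Phi\<close> are truncations. The case \<open>j = 1\<close> is
  separate because \<open>Q l 0\<close> is a dummy.
\<close>

definition formal_sol :: "nat \<Rightarrow> 'a::field_char_0 \<Rightarrow> 'a \<Rightarrow> 'a fps" where
  "formal_sol l \<delta> c = Abs_fps (\<lambda>j. if j = 1 then 1
     else if 2 \<le> j \<and> l dvd j - 1 then eval_yt (Q l ((j - 1) div l)) c \<delta> else 0)"

text \<open>
  Subtracting the two conditions of \<open>U\<close> shows that the sum of all \<open>(j - 1) u j\<close> is \<open>n - i\<close>, which
  bounds each summand.
\<close>

lemma U_support_bound:
  assumes "u \<in> U n i" "k \<in> {1..n}"
  shows "i + (k - 1) * u k \<le> n"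
proof -
  have sums: "(\<Sum>j = 1..n. u j) = i" "(\<Sum>j = 1..n. j * u j) = n"
    using assms by (auto simp: U_def)
  have "i + (\<Sum>j = 1..n. (j - 1) * u j) = (\<Sum>j = 1..n. u j + (j - 1) * u j)"
    using sums by (simp add: sum.distrib)
  also have "\<dots> = (\<Sum>j = 1..n. j * u j)"
    by (intro sum.cong refl) (auto simp flip: mult_Suc)
  finally have "i + (\<Sum>j = 1..n. (j - 1) * u j) = n"
    using sums by simp
  moreover have "(k - 1) * u k \<le> (\<Sum>j = 1..n. (j - 1) * u j)"
    using assms by (intro member_le_sum[of k "{1..n}" "\<lambda>j. (j - 1) * u j"]) auto
  ultimately show ?thesis by linarith
qed

lemma mod_eq_1_iff_dvd:
  assumes "1 \<le> (j::nat)"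
  shows "j mod l = 1 mod l \<longleftrightarrow> l dvd j - 1"
  using mod_eq_dvd_iff_nat[of 1 j l] assms by simp

lemma finite_U: "finite (U n i)"
  unfolding U_def by (rule finite_subset[OF _ finite_PiE[of "{1..n}" "\<lambda>_. {0..i}"]]) auto

text \<open>
  For a series with exponents congruent to 1 modulo \<open>l\<close>, an exponent vector outside \<open>U_res\<close> hits a
  vanishing coefficient, since \<open>U_support_bound\<close> excludes nonzero entries near the upper end.
\<close>

lemma fps_power_nth_U_res:
  fixes f :: "'a::field_char_0 fps"
  assumes f0: "fps_nth f 0 = 0" and gap: "\<And>j. 1 \<le> j \<Longrightarrow> \<not> l dvd j - 1 \<Longrightarrow> fps_nth f j = 0"
  shows "fps_nth (f ^ i) n = (\<Sum>u\<in>U_res l n i. of_rat (B n i u) * (\<Prod>j = 1..n. fps_nth f j ^ u j))"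
  unfolding fps_power_nth_U[OF f0]
proof (rule sum.mono_neutral_right)
  show "\<forall>u\<in>U n i - U_res l n i. of_rat (B n i u) * (\<Prod>j = 1..n. fps_nth f j ^ u j) = 0"
  proof
    fix u assume u: "u \<in> U n i - U_res l n i"
    then have in_U: "u \<in> U n i" by blast
    have "u j = 0" if "j \<in> {n - i + 2..n}" for j
    proof (rule ccontr)
      assume "u j \<noteq> 0"
      then have "j - 1 \<le> (j - 1) * u j" by simp
      moreover have "i + (j - 1) * u j \<le> n" using that by (intro U_support_bound[OF in_U]) auto
      ultimately have "i + (j - 1) \<le> n" by linarith
      then show False using that by auto
    qed
    then obtain j where j: "j \<in> {2..n - i + 1}" "j mod l \<noteq> 1 mod l" "u j \<noteq> 0"
      using u by (auto simp: U_res_def)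
    have "j \<le> n"
    proof (rule ccontr)
      assume "\<not> j \<le> n"
      then have "i = 0" using j(1) by auto
      then have "n = 0" using in_U by (auto simp: U_def)
      then show False using j(1) by simp
    qed
    then have "j \<in> {1..n}" using j(1) by simp
    moreover have "fps_nth f j = 0"
      using j gap[of j] mod_eq_1_iff_dvd[of j l] by auto
    ultimately have "(\<Prod>j = 1..n. fps_nth f j ^ u j) = 0"
      using j(3) by (intro prod_zero) auto
    then show "of_rat (B n i u) * (\<Prod>j = 1..n. fps_nth f j ^ u j) = 0" by simp
  qed
qed (auto simp: U_res_def finite_U)

text \<open>
  The recursion for \<open>Q\<close> multiplies over \<open>p\<close>, the multinomial formula over all exponents. They agree
  when \<open>u\<close> is supported on \<open>1\<close>, where the coefficient of \<open>f\<close> is 1, and on the exponents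
  \<open>p * l + 1\<close> with \<open>p \<le> k\<close>.
\<close>

lemma prod_over_progression:
  fixes f :: "'a::field_char_0 fps"
  assumes f1: "fps_nth f 1 = 1" and l: "1 \<le> l" and kn: "k * l + 1 \<le> n"
    and supp: "\<And>j. 2 \<le> j \<Longrightarrow> j \<le> n \<Longrightarrow> u j \<noteq> 0 \<Longrightarrow> l dvd j - 1 \<and> j \<le> k * l + 1"
  shows "(\<Prod>j = 1..n. fps_nth f j ^ u j) = (\<Prod>p = 1..k. fps_nth f (p * l + 1) ^ u (p * l + 1))"
proof -
  have "(\<Prod>p = 1..k. fps_nth f (p * l + 1) ^ u (p * l + 1))
      = (\<Prod>j\<in>(\<lambda>p. p * l + 1) ` {1..k}. fps_nth f j ^ u j)"
    using l by (subst prod.reindex) (auto simp: inj_on_def)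
  also have "\<dots> = (\<Prod>j = 1..n. fps_nth f j ^ u j)"
  proof (rule prod.mono_neutral_left)
    have "p * l + 1 \<le> n" if "p \<le> k" for p
      using kn mult_le_mono1[OF that, of l] by linarith
    then show "(\<lambda>p. p * l + 1) ` {1..k} \<subseteq> {1..n}" by auto
    show "\<forall>j\<in>{1..n} - (\<lambda>p. p * l + 1) ` {1..k}. fps_nth f j ^ u j = 1"
    proof
      fix j assume j: "j \<in> {1..n} - (\<lambda>p. p * l + 1) ` {1..k}"
      show "fps_nth f j ^ u j = 1"
      proof (cases "j = 1 \<or> u j = 0")
        case False
        then have j2: "2 \<le> j" "u j \<noteq> 0" using j by auto
        then have "l dvd j - 1" "j \<le> k * l + 1" using supp[of j] j by auto
        then obtain p where p: "j - 1 = p * l" by (metis dvd_def mult.commute)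
        then have "p * l \<le> k * l" using \<open>j \<le> k * l + 1\<close> by linarith
        then have "p \<le> k" using l by simp
        moreover have "1 \<le> p" using p j2 by (cases "p = 0") auto
        moreover have "j = p * l + 1" using p j2 by linarith
        ultimately have "j \<in> (\<lambda>p. p * l + 1) ` {1..k}" by auto
        then show ?thesis using j by simp
      qed (use f1 in auto)
    qed
  qed simp
  finally show ?thesis ..
qed

lemma U_res_support:
  assumes "u \<in> U_res l n i" "2 \<le> j" "j \<le> n" "u j \<noteq> 0"
  shows "l dvd j - 1 \<and> j \<le> n - i + 1"
proof -
  have "j \<notin> {n - i + 2..n}" using assms by (auto simp: U_res_def)
  then have "j \<in> {2..n - i + 1}" using assms by auto
  then have "j mod l = 1 mod l" using assms by (auto simp: U_res_def)
  then show ?thesis using mod_eq_1_iff_dvd[of j l] assms \<open>j \<in> {2..n - i + 1}\<close> by simp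
qed

lemma formal_sol_nth:
  "fps_nth (formal_sol l \<delta> c) 0 = 0" "fps_nth (formal_sol l \<delta> c) (Suc 0) = 1"
  "1 \<le> j \<Longrightarrow> \<not> l dvd j - 1 \<Longrightarrow> fps_nth (formal_sol l \<delta> c) j = 0"
  "1 \<le> l \<Longrightarrow> 1 \<le> p \<Longrightarrow> fps_nth (formal_sol l \<delta> c) (p * l + 1) = eval_yt (Q l p) c \<delta>"
  by (auto simp: formal_sol_def)

text \<open>
  A product of \<open>k l + 1\<close> exponents congruent to 1 modulo \<open>l\<close> is again congruent to 1 in total degree.
\<close>

lemma formal_sol_power_nth_off:
  assumes "n = 0 \<or> \<not> l dvd n - 1"
  shows "fps_nth (formal_sol l \<delta> c ^ (k * l + 1)) n = 0"
proof (cases "n = 0")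
  case False
  let ?f = "formal_sol l \<delta> c"
  have zero: "(\<Prod>j = 1..n. fps_nth ?f j ^ u j) = 0" if u: "u \<in> U n (k * l + 1)" for u
  proof (rule ccontr)
    assume nz: "(\<Prod>j = 1..n. fps_nth ?f j ^ u j) \<noteq> 0"
    have sums: "(\<Sum>j = 1..n. u j) = k * l + 1" "(\<Sum>j = 1..n. j * u j) = n"
      using u by (auto simp: U_def)
    have "l dvd (j - 1) * u j" if "j \<in> {1..n}" for j
    proof (cases "u j = 0")
      case False
      then have "fps_nth ?f j \<noteq> 0" using nz that by auto
      then have "l dvd j - 1" using formal_sol_nth(3)[of j l \<delta> c] that by (metis atLeastAtMost_iff)
      then show ?thesis by (rule dvd_mult2)
    qed simp
    then have "l dvd (\<Sum>j = 1..n. (j - 1) * u j)" by (rule dvd_sum)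
    moreover have "(\<Sum>j = 1..n. (j - 1) * u j) + (\<Sum>j = 1..n. u j) = (\<Sum>j = 1..n. j * u j)"
      unfolding sum.distrib[symmetric]
    proof (intro sum.cong refl)
      fix j assume "j \<in> {1..n}"
      then show "(j - 1) * u j + u j = j * u j" by (cases j) auto
    qed
    ultimately obtain D where "l dvd D" "D + (k * l + 1) = n" using sums by metis
    then have "l dvd n - 1" by (auto intro!: dvd_add)
    then show False using assms False by blast
  qed
  show ?thesis
    unfolding fps_power_nth_U[OF formal_sol_nth(1)] by (intro sum.neutral ballI) (simp only: zero mult_zero_right)
qed (simp add: fps_power_zeroth formal_sol_nth(1))

text \<open>
  The coefficient of the unknown \<open>Q l q\<close> is \<open>l + 1\<close>; what remains is the sum over \<open>U_check\<close>, where
  the exponent vectors involving the unknown are left out.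
\<close>

lemma formal_sol_power_nth_leading:
  assumes l: "1 \<le> l" and q: "2 \<le> q" and n: "n = (q + 1) * l + 1"
  shows "fps_nth (formal_sol l \<delta> c ^ (l + 1)) n =
    (\<Sum>u\<in>U_check l n. of_rat (B n (l + 1) u) * (\<Prod>p = 1..q - 1. eval_yt (Q l p) c \<delta> ^ u (p * l + 1)))
    + of_nat (l + 1) * eval_yt (Q l q) c \<delta>"
proof -
  let ?f = "formal_sol l \<delta> c"
  define m where "m = q * l + 1"
  have f01: "fps_nth ?f 0 = 0" "fps_nth ?f 1 = 1"
    using formal_sol_nth(1,2)[of l \<delta> c] by simp_all
  have "1 * 1 \<le> q * l" using l q by (intro mult_le_mono) auto
  then have m: "2 \<le> m" "n = m + l" "n - l = m" "m \<le> n" "n - (l + 1) + 1 = m"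
    using n by (auto simp: m_def)
  \<comment> \<open>The series with the unknown coefficient, the one at \<open>x ^ m\<close>, replaced by zero.\<close>
  define g where "g = Abs_fps (\<lambda>j. if j = m then 0 else fps_nth ?f j)"
  have g: "fps_nth g j = (if j = m then 0 else fps_nth ?f j)" for j
    by (simp add: g_def)
  have agree: "fps_nth ?f j = fps_nth g j" if "j < m" for j
    using that by (simp add: g)
  have "fps_nth (?f ^ Suc l) n = fps_nth (g ^ Suc l) n + of_nat (l + 1) * fps_nth ?f m"
    unfolding m(2) using fps_power_nth_first_diff[OF f01(1) m(1) agree, where k = l]
    unfolding f01 g by simp
  moreover have "fps_nth ?f m = eval_yt (Q l q) c \<delta>"
    unfolding m_def using l q by (intro formal_sol_nth(4)) auto
  moreover have "fps_nth (g ^ Suc l) n = (\<Sum>u\<in>U_check l n. of_rat (B n (l + 1) u)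
      * (\<Prod>p = 1..q - 1. eval_yt (Q l p) c \<delta> ^ u (p * l + 1)))"
  proof -
    have "fps_nth (g ^ Suc l) n
        = (\<Sum>u\<in>U_res l n (l + 1). of_rat (B n (l + 1) u) * (\<Prod>j = 1..n. fps_nth g j ^ u j))"
      unfolding Suc_eq_plus1 using m(1) f01 formal_sol_nth(3)[of _ l \<delta> c]
      by (intro fps_power_nth_U_res) (auto simp: g)
    also have "\<dots> = (\<Sum>u\<in>U_check l n. of_rat (B n (l + 1) u) * (\<Prod>j = 1..n. fps_nth g j ^ u j))"
    proof (rule sum.mono_neutral_right)
      show "\<forall>u\<in>U_res l n (l + 1) - U_check l n.
          of_rat (B n (l + 1) u) * (\<Prod>j = 1..n. fps_nth g j ^ u j) = 0"
      proof
        fix u assume "u \<in> U_res l n (l + 1) - U_check l n"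
        then have "u m \<noteq> 0" using m(3) by (auto simp: U_check_def)
        moreover have "m \<in> {1..n}" using m(1,4) by simp
        ultimately have "(\<Prod>j = 1..n. fps_nth g j ^ u j) = 0"
          using g[of m] by (intro prod_zero) (auto intro!: bexI[of _ m])
        then show "of_rat (B n (l + 1) u) * (\<Prod>j = 1..n. fps_nth g j ^ u j) = 0" by simp
      qed
    qed (auto simp: U_res_def U_check_def finite_U)
    also have "\<dots> = (\<Sum>u\<in>U_check l n. of_rat (B n (l + 1) u)
      * (\<Prod>p = 1..q - 1. eval_yt (Q l p) c \<delta> ^ u (p * l + 1)))"
    proof (intro sum.cong refl arg_cong2[where f = "(*)"])
      fix u assume "u \<in> U_check l n"
      then have u: "u \<in> U_res l n (l + 1)" "u m = 0" using m(3) by (auto simp: U_check_def)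
      have "(q - 1) * l + 1 \<le> m" unfolding m_def by (simp add: mult_le_mono1)
      moreover have small: "j \<le> (q - 1) * l + 1" if j: "2 \<le> j" "l dvd j - 1" "j \<le> m" "j \<noteq> m" for j
      proof -
        obtain p where p: "j - 1 = p * l" using j(2) by (metis dvd_def mult.commute)
        then have "p * l < q * l" using j unfolding m_def by linarith
        then have "p \<le> q - 1" by auto
        then have "p * l \<le> (q - 1) * l" by (rule mult_le_mono1)
        then show ?thesis using p j by linarith
      qed
      ultimately have "(\<Prod>j = 1..n. fps_nth g j ^ u j) = (\<Prod>p = 1..q - 1. fps_nth g (p * l + 1) ^ u (p * l + 1))"
      proof (intro prod_over_progression l)
        show "fps_nth g 1 = 1" using m(1) f01 by (simp add: g)
        show "(q - 1) * l + 1 \<le> n" using \<open>(q - 1) * l + 1 \<le> m\<close> m(4) by linarith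
        fix j assume j: "2 \<le> j" "j \<le> n" "u j \<noteq> 0"
        then have "l dvd j - 1" "j \<le> m" using U_res_support[OF u(1) j] m(5) by auto
        moreover have "j \<noteq> m" using j(3) u(2) by auto
        ultimately show "l dvd j - 1 \<and> j \<le> (q - 1) * l + 1"
          using small[of j] j(1) by blast
      qed
      also have "\<dots> = (\<Prod>p = 1..q - 1. eval_yt (Q l p) c \<delta> ^ u (p * l + 1))"
      proof (intro prod.cong refl arg_cong2[where f = "(^)"])
        fix p assume "p \<in> {1..q - 1}"
        then have "p \<noteq> q" "1 \<le> p" by auto
        then have "p * l + 1 \<noteq> m" using l by (auto simp: m_def)
        then show "fps_nth g (p * l + 1) = eval_yt (Q l p) c \<delta>"
          using formal_sol_nth(4)[OF l \<open>1 \<le> p\<close>] by (simp add: g)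
      qed
      finally show "(\<Prod>j = 1..n. fps_nth g j ^ u j) = (\<Prod>p = 1..q - 1. eval_yt (Q l p) c \<delta> ^ u (p * l + 1))" .
    qed
    finally show ?thesis .
  qed
  ultimately show ?thesis by simp
qed

text \<open>
  Here the unknown \<open>Q l q\<close> is out of reach: with \<open>2 l + 1\<close> factors, no exponent exceeds
  \<open>(q - 1) l + 1\<close>.
\<close>

lemma formal_sol_power_nth_second:
  assumes l: "1 \<le> l" and q: "2 \<le> q" and n: "n = (q + 1) * l + 1"
  shows "fps_nth (formal_sol l \<delta> c ^ (2 * l + 1)) n = (\<Sum>u\<in>U_res l n (2 * l + 1).
    of_rat (B n (2 * l + 1) u) * (\<Prod>p = 1..q - 1. eval_yt (Q l p) c \<delta> ^ u (p * l + 1)))"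
proof -
  let ?f = "formal_sol l \<delta> c"
  have n': "n - (2 * l + 1) + 1 = (q - 1) * l + 1" "(q - 1) * l + 1 \<le> n"
    using q unfolding n by (cases q; simp)+
  have "fps_nth (?f ^ (2 * l + 1)) n
      = (\<Sum>u\<in>U_res l n (2 * l + 1). of_rat (B n (2 * l + 1) u) * (\<Prod>j = 1..n. fps_nth ?f j ^ u j))"
    by (intro fps_power_nth_U_res) (auto simp: formal_sol_nth)
  also have "\<dots> = (\<Sum>u\<in>U_res l n (2 * l + 1). of_rat (B n (2 * l + 1) u)
      * (\<Prod>p = 1..q - 1. eval_yt (Q l p) c \<delta> ^ u (p * l + 1)))"
  proof (intro sum.cong refl arg_cong2[where f = "(*)"])
    fix u assume u: "u \<in> U_res l n (2 * l + 1)"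
    have "(\<Prod>j = 1..n. fps_nth ?f j ^ u j) = (\<Prod>p = 1..q - 1. fps_nth ?f (p * l + 1) ^ u (p * l + 1))"
    proof (intro prod_over_progression l n'(2))
      fix j assume "2 \<le> j" "j \<le> n" "u j \<noteq> 0"
      then show "l dvd j - 1 \<and> j \<le> (q - 1) * l + 1"
        using U_res_support[OF u, of j] unfolding n'(1) by blast
    qed (simp add: formal_sol_nth(2))
    also have "\<dots> = (\<Prod>p = 1..q - 1. eval_yt (Q l p) c \<delta> ^ u (p * l + 1))"
      using formal_sol_nth(4)[OF l, of _ \<delta> c] by (intro prod.cong refl) auto
    finally show "(\<Prod>j = 1..n. fps_nth ?f j ^ u j) = (\<Prod>p = 1..q - 1. eval_yt (Q l p) c \<delta> ^ u (p * l + 1))" .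
  qed
  finally show ?thesis .
qed

definition normal_form :: "nat \<Rightarrow> 'a::field_char_0 \<Rightarrow> 'a fps" where
  "normal_form l \<delta> = fps_X ^ (l + 1) + fps_const \<delta> * fps_X ^ (2 * l + 1)"

lemma normal_form_compose:
  "fps_nth f 0 = 0 \<Longrightarrow> normal_form l \<delta> oo f = f ^ (l + 1) + fps_const \<delta> * f ^ (2 * l + 1)"
  by (simp add: normal_form_def fps_compose_add_distrib fps_compose_mult_distrib fps_compose_power[symmetric] del: power_Suc)

lemma normal_form_deriv_nth:
  fixes f :: "'a::field_char_0 fps"
  shows "fps_nth (fps_deriv f * normal_form l \<delta>) n =
    (if n < l + 1 then 0 else of_nat (n - l) * fps_nth f (n - l))
    + \<delta> * (if n < 2 * l + 1 then 0 else of_nat (n - 2 * l) * fps_nth f (n - 2 * l))"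
proof -
  have "fps_deriv f * normal_form l \<delta>
      = fps_X ^ (l + 1) * fps_deriv f + fps_const \<delta> * (fps_X ^ (2 * l + 1) * fps_deriv f)"
    by (simp only: normal_form_def algebra_simps)
  moreover have shift: "fps_nth (fps_X ^ (k + 1) * fps_deriv f) n
      = (if n < k + 1 then 0 else of_nat (n - k) * fps_nth f (n - k))" for k
  proof (cases "n < k + 1")
    case False
    then obtain i where "n = k + 1 + i" by (metis le_Suc_ex linorder_not_less)
    then show ?thesis by (simp add: fps_X_power_mult_nth del: power_Suc)
  qed (simp add: fps_X_power_mult_nth del: power_Suc)
  ultimately show ?thesis
    by (simp only: fps_add_nth fps_mult_left_const_nth shift)
qed

text \<open>
  Both sides vanish at exponents not congruent to 1 modulo \<open>l\<close>. At \<open>x ^ (l+1)\<close> and \<open>x ^ (2l+1)\<close> the equation holds whatever \<open>c\<close> is, and from \<open>x ^ (3l+1)\<close> on it is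
  the recursion for \<open>Q\<close>: the difference between \<open>q l + 1\<close>, from the derivative, and \<open>l + 1\<close>, from
  the power, is the factor \<open>(q - 1) l\<close> by which the recursion divides.
\<close>

lemma formal_sol_transports:
  fixes c \<delta> :: "'a::field_char_0"
  assumes l: "1 \<le> l"
  shows "transports s (formal_sol l \<delta> c) (normal_form l \<delta>) (normal_form l \<delta>)"
proof -
  let ?f = "formal_sol l \<delta> c"
  have "fps_nth (normal_form l \<delta> oo ?f) n = fps_nth (fps_deriv ?f * normal_form l \<delta>) n" for n
  proof (cases "n = 0 \<or> \<not> l dvd n - 1")
    case True
    have "fps_nth (?f ^ (l + 1)) n = 0" "fps_nth (?f ^ (2 * l + 1)) n = 0"
      using formal_sol_power_nth_off[OF True, of \<delta> c 1] formal_sol_power_nth_off[OF True, of \<delta> c 2]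
      by simp_all
    moreover have off: "fps_nth ?f (n - k * l) = 0" if "k * l + 1 \<le> n" for k
    proof -
      have "n - 1 = (n - k * l - 1) + k * l" using that by linarith
      then have "\<not> l dvd n - k * l - 1" using True that dvd_add[of l "n - k * l - 1" "k * l"] by auto
      then show ?thesis using that by (intro formal_sol_nth) auto
    qed
    ultimately show ?thesis
      using off[of 1] off[of 2] unfolding normal_form_compose[OF formal_sol_nth(1)] normal_form_deriv_nth
      by auto
  next
    case False
    then obtain k where "n - 1 = k * l" by (metis dvd_def mult.commute)
    then have nk: "n = k * l + 1" using False by linarith
    have lhs: "fps_nth (normal_form l \<delta> oo ?f) n
        = fps_nth (?f ^ (l + 1)) n + \<delta> * fps_nth (?f ^ (2 * l + 1)) n"
      unfolding normal_form_compose[OF formal_sol_nth(1)] by simp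
    have low: "fps_nth (?f ^ i) n = 0" if "n < i" for i
      using startsby_zero_power_prefix[of ?f i] formal_sol_nth(1)[of l \<delta> c] that by simp
    have diag: "fps_nth (?f ^ i) i = 1" for i
      using startsby_zero_power_nth_same[of ?f i] formal_sol_nth(1,2)[of l \<delta> c] by simp
    have "k = 0 \<or> k = 1 \<or> k = 2 \<or> 2 \<le> k - 1 \<and> k = (k - 1) + 1" by linarith
    then consider "k = 0" | "k = 1" | "k = 2" | q where "2 \<le> q" "k = q + 1" by blast
    then show ?thesis
    proof cases
      case 1
      then show ?thesis using l low[of "l + 1"] low[of "2 * l + 1"]
        unfolding lhs normal_form_deriv_nth by (simp add: nk)
    next
      case 2
      then show ?thesis using l diag[of "l + 1"] low[of "2 * l + 1"]
        unfolding lhs normal_form_deriv_nth by (simp add: nk formal_sol_nth(2))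
    next
      case 3
      then have n: "n = (l + 1) + l" using nk by simp
      have agree: "fps_nth ?f j = fps_nth fps_X j" if "j < l + 1" for j
        using that by (auto simp: formal_sol_def fps_X_nth dest: dvd_imp_le)
      have "2 \<le> l + 1" using l by simp
      then have "fps_nth (?f ^ Suc l) n = fps_nth (fps_X ^ Suc l) n + of_nat (Suc l) * fps_nth ?f (l + 1)"
        unfolding n using fps_power_nth_first_diff[OF formal_sol_nth(1) _ agree, of "l + 1" l] l
        by (simp add: formal_sol_nth(2) del: power_Suc)
      then have "fps_nth (?f ^ (l + 1)) n = of_nat (l + 1) * fps_nth ?f (l + 1)"
        using l n by (simp add: fps_X_power_nth del: power_Suc)
      then show ?thesis using diag[of "2 * l + 1"] n
        unfolding lhs normal_form_deriv_nth by (simp add: formal_sol_nth(2) mult_2)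
    next
      case 4
      define a where "a p = eval_yt (Q l p) c \<delta>" for p
      define X where "X = (\<Sum>u\<in>U_check l n. of_rat (B n (l + 1) u) * (\<Prod>p = 1..q - 1. a p ^ u (p * l + 1)))"
      define Y where "Y = (\<Sum>u\<in>U_res l n (2 * l + 1).
        of_rat (B n (2 * l + 1) u) * (\<Prod>p = 1..q - 1. a p ^ u (p * l + 1)))"
      have n: "n = (q + 1) * l + 1" using nk 4 by simp
      have "a q = 1 / of_nat ((q - 1) * l) * (X + \<delta> * Y - \<delta> * of_nat ((q - 1) * l + 1) * a (q - 1))"
        unfolding a_def X_def Y_def by (rule eval_Q_rec[OF 4(1) n])
      moreover have "of_nat ((q - 1) * l) \<noteq> (0 :: 'a)"
        unfolding of_nat_eq_0_iff using 4 l by auto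
      ultimately have rec: "of_nat ((q - 1) * l) * a q = X + \<delta> * Y - \<delta> * of_nat ((q - 1) * l + 1) * a (q - 1)"
        by simp
      have "fps_nth (?f ^ (l + 1)) n = X + of_nat (l + 1) * a q"
        unfolding a_def X_def by (rule formal_sol_power_nth_leading[OF l 4(1) n])
      moreover have "fps_nth (?f ^ (2 * l + 1)) n = Y"
        unfolding a_def Y_def by (rule formal_sol_power_nth_second[OF l 4(1) n])
      moreover have "n - l = q * l + 1" "n - 2 * l = (q - 1) * l + 1" "\<not> n < l + 1" "\<not> n < 2 * l + 1"
        using 4(1) unfolding n by (cases q; simp)+
      moreover have "fps_nth ?f (q * l + 1) = a q" "fps_nth ?f ((q - 1) * l + 1) = a (q - 1)"
        unfolding a_def using 4(1) by (intro formal_sol_nth(4)[OF l]; simp)+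
      moreover have "of_nat (q * l + 1) = of_nat ((q - 1) * l) + (of_nat (l + 1) :: 'a)"
        unfolding of_nat_add[symmetric] using 4(1) by (intro arg_cong[where f = of_nat]) (cases q; simp)
      ultimately show ?thesis
        unfolding lhs normal_form_deriv_nth using rec by (simp only: if_False) (simp add: algebra_simps)
    qed
  qed
  then show ?thesis by (simp add: transports_def fcong_def)
qed


section \<open>Series close to the identity\<close>

text \<open>
  Write \<open>f = x + h\<close> with \<open>h\<close> of order above \<open>a\<close>. Then \<open>f \<circ> g = g + h \<circ> g\<close>, and up to order \<open>a + b\<close>
  the powers of \<open>g\<close> that \<open>h \<circ> g\<close> involves cannot be told from powers of \<open>x\<close>.
\<close>

lemma fps_compose_near_id:
  fixes f g :: "'a::idom fps"
  assumes f: "\<And>i. i \<le> a \<Longrightarrow> fps_nth f i = fps_nth fps_X i" and a: "1 \<le> a"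
    and g: "\<And>i. i \<le> b \<Longrightarrow> fps_nth g i = fps_nth fps_X i" and b: "1 \<le> b"
    and j: "j \<le> a + b"
  shows "fps_nth (f oo g) j = fps_nth f j + fps_nth g j - fps_nth fps_X j"
proof -
  have g0: "fps_nth g 0 = 0" using g[of 0] by simp
  have pow: "fps_nth (g ^ i) j = (if i = j then 1 else 0)" if "a < i" for i
  proof -
    have k: "i = Suc (i - 1)" "a \<le> i - 1" using that by simp_all
    have "fps_nth (g ^ Suc (i - 1)) j = fps_nth (fps_X ^ Suc (i - 1)) j"
      by (rule fps_power_nth_agree[of g "b + 1" fps_X j "i - 1"]) (use g g0 b j k in auto)
    then have "fps_nth (g ^ i) j = fps_nth (fps_X ^ i) j" by (simp only: k(1)[symmetric])
    then show ?thesis by (auto simp: fps_X_power_nth simp del: power_Suc)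
  qed
  define h where "h = f - fps_X"
  have "fps_nth (h oo g) j = (\<Sum>i = 0..j. if i = j then fps_nth h i else 0)"
    unfolding fps_compose_nth
  proof (intro sum.cong refl)
    fix i assume "i \<in> {0..j}"
    show "fps_nth h i * fps_nth (g ^ i) j = (if i = j then fps_nth h i else 0)"
    proof (cases "i \<le> a")
      case True
      then have "fps_nth h i = 0" using f by (simp add: h_def)
      then show ?thesis by (cases "i = j") auto
    qed (use pow in auto)
  qed
  then have "fps_nth (h oo g) j = fps_nth h j" by simp
  moreover have "f oo g = g + (h oo g)"
    using g0 by (simp add: h_def fps_compose_sub_distrib)
  ultimately show ?thesis by (simp add: h_def)
qed

lemma lin_nth: "fps_nth (lin c) j = (if j = 1 then c else 0)"
  by (auto simp: lin_def)

lemma lin_compose: "fps_nth g 0 = 0 \<Longrightarrow> lin c oo g = fps_const c * g"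
  by (simp add: lin_def fps_compose_mult_distrib)

lemma compose_lin_nth: "fps_nth (f oo lin c) j = c ^ j * fps_nth f j"
  unfolding lin_def fps_compose_linear by simp

lemma normal_form_low:
  "i \<le> l \<Longrightarrow> fps_nth (normal_form l \<delta>) i = 0"
  "1 \<le> l \<Longrightarrow> fps_nth (normal_form l \<delta>) (l + 1) = 1"
  by (simp_all add: normal_form_def fps_X_power_nth del: power_Suc)

lemma bar_Phi_nth:
  "fps_nth (bar_Phi l s b) j = fps_nth fps_X j + (if j \<in> {s - l + 1..s} then b j else 0)"
proof -
  have "fps_nth (\<Sum>i = s - l + 1..s. fps_const (b i) * fps_X ^ i) j
      = (\<Sum>i = s - l + 1..s. if j = i then b i else 0)"
    unfolding fps_sum_nth by (intro sum.cong) (auto simp: fps_X_power_nth)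
  also have "\<dots> = (if j \<in> {s - l + 1..s} then b j else 0)"
    by (subst sum.delta') auto
  finally show ?thesis by (simp add: bar_Phi_def)
qed

lemma sum_progression_nth:
  assumes "1 \<le> l"
  shows "fps_nth (\<Sum>p = m..n. fps_const (g p) * fps_X ^ (p * l + 1)) j
    = (if 1 \<le> j \<and> l dvd j - 1 \<and> (j - 1) div l \<in> {m..n} then g ((j - 1) div l) else 0)"
proof -
  have iff: "j = p * l + 1 \<longleftrightarrow> 1 \<le> j \<and> l dvd j - 1 \<and> p = (j - 1) div l" for p
    using assms by auto
  have "fps_nth (\<Sum>p = m..n. fps_const (g p) * fps_X ^ (p * l + 1)) j
      = (\<Sum>p = m..n. if j = p * l + 1 then g p else 0)"
    unfolding fps_sum_nth by (intro sum.cong) (auto simp: fps_X_power_nth simp del: power_Suc)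
  also have "\<dots> = (\<Sum>p = m..n. if p = (j - 1) div l then (if 1 \<le> j \<and> l dvd j - 1 then g p else 0) else 0)"
    unfolding iff by (intro sum.cong) auto
  also have "\<dots> = (if 1 \<le> j \<and> l dvd j - 1 \<and> (j - 1) div l \<in> {m..n} then g ((j - 1) div l) else 0)"
    by (subst sum.delta) auto
  finally show ?thesis .
qed


section \<open>Solutions of the normal form to finite order\<close>

text \<open>
  The bounds on \<open>r\<close> say that \<open>r l + 1\<close> is the largest exponent up to \<open>s\<close> in the progression.
\<close>

locale normal_form_setting =
  fixes l s r :: nat and \<delta> :: "'a::field_char_0"
  assumes l: "1 \<le> l" and s: "2 * l + 1 \<le> s" and r: "r * l + 1 \<le> s" "s \<le> (r + 1) * l"
begin

abbreviation "G \<equiv> (subst_group (enat s) :: 'a fps monoid)"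
abbreviation "Ht \<equiv> normal_form l \<delta>"
abbreviation "tilde c \<equiv> tilde_Phi l r \<delta> c"
abbreviation "bar b \<equiv> bar_Phi l s b"
abbreviation "hat c1 c \<equiv> hat_Phi l s r \<delta> c1 c"

lemma s1: "1 \<le> enat s"
  using s by (simp add: one_enat_def)

sublocale G: group G
  by (rule subst_group_is_group[OF s1])

sublocale K: group "AJ_group (enat s) Ht"
  by (rule AJ_group_is_group[OF s1]) (simp add: normal_form_low)

lemma r2: "2 \<le> r"
proof (rule ccontr)
  assume "\<not> 2 \<le> r"
  then have "(r + 1) * l \<le> 2 * l" by (intro mult_le_mono1) simp
  then show False using s r by linarith
qed

lemma top_range: "l + 2 \<le> s - l + 1" "s - l + 1 \<le> r * l + 1"
  using s r by auto

lemma roots1_nonzero: "c \<in> roots1 l \<Longrightarrow> c \<noteq> 0"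
  using l by (auto simp: roots1_def power_0_left)

lemma tilde_eq: "tilde c = fps_trunc s (formal_sol l \<delta> c)"
proof (rule fps_ext)
  fix j
  have range: "j \<le> s \<longleftrightarrow> (j - 1) div l \<le> r" if "1 \<le> j" "l dvd j - 1"
  proof -
    obtain p where p: "j - 1 = p * l" using \<open>l dvd j - 1\<close> by (metis dvd_def mult.commute)
    then have j: "j = p * l + 1" using that by linarith
    have "p \<le> r" if "j \<le> s"
    proof (rule ccontr)
      assume "\<not> p \<le> r"
      then have "(r + 1) * l \<le> p * l" by (intro mult_le_mono1) simp
      then show False using that r j by linarith
    qed
    moreover have "j \<le> s" if "p \<le> r"
      using mult_le_mono1[OF that, of l] r j by linarith
    ultimately show ?thesis using p l by auto
  qed
  have one: "(j - 1) div l = 1 \<longleftrightarrow> j = l + 1" if "1 \<le> j" "l dvd j - 1"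
    using that l by auto
  have zero: "(j - 1) div l = 0 \<longleftrightarrow> j = 1" if "1 \<le> j" "l dvd j - 1"
    using that l by auto
  have "fps_nth (tilde c) j = (if j = 1 then 1 else 0) + (if j = l + 1 then c else 0)
      + (if 1 \<le> j \<and> l dvd j - 1 \<and> (j - 1) div l \<in> {2..r} then eval_yt (Q l ((j - 1) div l)) c \<delta> else 0)"
    unfolding tilde_Phi_def fps_add_nth sum_progression_nth[OF l]
    by (simp add: fps_X_power_nth del: power_Suc)
  also have "\<dots> = fps_nth (fps_trunc s (formal_sol l \<delta> c)) j"
  proof (cases "1 \<le> j \<and> l dvd j - 1")
    case True
    note rng = range[OF conjunct1[OF True] conjunct2[OF True]]
      and one = one[OF conjunct1[OF True] conjunct2[OF True]]
      and zero = zero[OF conjunct1[OF True] conjunct2[OF True]]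
    consider "j = 1" | "j = l + 1" | "j \<noteq> 1" "j \<noteq> l + 1" by blast
    then show ?thesis
    proof cases
      case 1
      then show ?thesis using l s by (simp add: formal_sol_def)
    next
      case 2
      then show ?thesis using l s eval_Q_1[of l c \<delta>] by (simp add: formal_sol_def)
    next
      case 3
      then have "2 \<le> (j - 1) div l" using one zero by linarith
      then show ?thesis using 3 True rng by (simp add: formal_sol_def)
    qed
  next
    case False
    then have "j \<noteq> 1" "j \<noteq> l + 1" by auto
    then show ?thesis using False by (auto simp: formal_sol_def)
  qed
  finally show "fps_nth (tilde c) j = fps_nth (fps_trunc s (formal_sol l \<delta> c)) j" .
qed

lemma formal_sol_near_id: "i \<le> l \<Longrightarrow> fps_nth (formal_sol l \<delta> c) i = fps_nth fps_X i"
  by (auto simp: formal_sol_def fps_X_nth dest: dvd_imp_le)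

lemma formal_sol_free: "fps_nth (formal_sol l \<delta> c) (l + 1) = c"
  using formal_sol_nth(4)[OF l, of 1 \<delta> c] eval_Q_1[of l c \<delta>] by simp

lemma tilde_near_id: "i \<le> l \<Longrightarrow> fps_nth (tilde c) i = fps_nth fps_X i"
  using s by (simp add: tilde_eq formal_sol_near_id)

lemma bar_near_id: "i \<le> s - l \<Longrightarrow> fps_nth (bar b) i = fps_nth fps_X i"
  by (simp add: bar_Phi_nth)

lemma AJ_solution_unique:
  assumes "transports s' \<Phi> Ht Ht" "transports s' \<Psi> Ht Ht"
    and "fps_nth \<Phi> 0 = 0" "fps_nth \<Psi> 0 = 0" "fps_nth \<Phi> 1 = fps_nth \<Psi> 1"
    and "fps_nth \<Phi> 1 \<in> roots1 l" "fps_nth \<Phi> (l + 1) = fps_nth \<Psi> (l + 1)"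
    and "enat (m + l) \<le> s'"
  shows "fps_nth \<Phi> m = fps_nth \<Psi> m"
proof (rule AJ_solution_rigid[of l Ht s' \<Phi> \<Psi>])
  show "fps_nth \<Phi> 1 ^ l = 1" using assms(6) by (simp add: roots1_def)
  show "fps_nth Ht i = 0" if "i \<le> l" for i using normal_form_low(1)[OF that] .
qed (fact assms normal_form_low(2)[OF l])+

text \<open>
  Without truncation every equation counts, so rigidity leaves only the coefficient at \<open>x ^ (l+1)\<close>
  free.
\<close>

lemma AJ_sols1_infinity_iff:
  "\<Phi> \<in> AJ_sols1 \<infinity> Ht \<longleftrightarrow> (\<exists>c. \<Phi> = formal_sol l \<delta> c)"
proof
  assume \<Phi>: "\<Phi> \<in> AJ_sols1 \<infinity> Ht"
  then have \<Phi>': "transports \<infinity> \<Phi> Ht Ht" "fps_nth \<Phi> 0 = 0" "fps_nth \<Phi> 1 = 1"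
    by (simp_all add: AJ_sols1_def AJ_sols_iff subst_group1_def subst_carrier_iff)
  let ?c = "fps_nth \<Phi> (l + 1)"
  have "fps_nth \<Phi> m = fps_nth (formal_sol l \<delta> ?c) m" for m
  proof (rule AJ_solution_unique[OF \<Phi>'(1) formal_sol_transports[OF l] \<Phi>'(2)])
    show "fps_nth \<Phi> 1 \<in> roots1 l" unfolding \<Phi>'(3) by (simp add: roots1_def)
    show "fps_nth \<Phi> 1 = fps_nth (formal_sol l \<delta> ?c) 1"
      unfolding \<Phi>'(3) using formal_sol_nth(2)[of l \<delta> ?c] by simp
  qed (simp_all only: formal_sol_nth(1) formal_sol_free enat_ord_simps)
  then have "\<Phi> = formal_sol l \<delta> ?c" by (rule fps_ext)
  then show "\<exists>c. \<Phi> = formal_sol l \<delta> c" by blast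
next
  assume "\<exists>c. \<Phi> = formal_sol l \<delta> c"
  then obtain c where \<Phi>: "\<Phi> = formal_sol l \<delta> c" ..
  have "transports \<infinity> \<Phi> Ht Ht" unfolding \<Phi> by (rule formal_sol_transports[OF l])
  then show "\<Phi> \<in> AJ_sols1 \<infinity> Ht"
    by (auto simp: AJ_sols1_def AJ_sols_iff subst_group1_def subst_carrier_iff formal_sol_nth(1,2) fps_eq_iff \<Phi>)
qed

text \<open>
  The composition is a formal solution again, so its coefficient at \<open>x ^ (l+1)\<close> identifies it.
\<close>

lemma formal_sol_compose: "formal_sol l \<delta> c oo formal_sol l \<delta> d = formal_sol l \<delta> (c + d)"
proof (rule fps_ext)
  fix m
  let ?f = "formal_sol l \<delta>"
  have start: "fps_nth (?f c oo ?f d) 0 = 0" "fps_nth (?f c oo ?f d) 1 = 1"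
    using formal_sol_nth(1,2)[of l \<delta>] fps_compose_nth_1[of "?f c" "?f d"] by simp_all
  have "fps_nth (?f c oo ?f d) (l + 1) = fps_nth (?f c) (l + 1) + fps_nth (?f d) (l + 1) - fps_nth fps_X (l + 1)"
    by (rule fps_compose_near_id[OF _ l _ l]) (use l in \<open>simp_all add: formal_sol_near_id\<close>)
  then have free: "fps_nth (?f c oo ?f d) (l + 1) = c + d"
    unfolding formal_sol_free using l by simp
  show "fps_nth (?f c oo ?f d) m = fps_nth (?f (c + d)) m"
  proof (rule AJ_solution_unique)
    show "transports \<infinity> (?f c oo ?f d) Ht Ht"
      by (intro transports_compose[of _ _ Ht Ht] formal_sol_transports[OF l] formal_sol_nth(1))
    show "transports \<infinity> (?f (c + d)) Ht Ht" by (rule formal_sol_transports[OF l])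
    show "fps_nth (?f c oo ?f d) 1 \<in> roots1 l" unfolding start by (simp add: roots1_def)
    show "fps_nth (?f c oo ?f d) 1 = fps_nth (?f (c + d)) 1"
      unfolding start using formal_sol_nth(2)[of l \<delta> "c + d"] by simp
  qed (simp_all only: start free formal_sol_nth(1) formal_sol_free enat_ord_simps)
qed

lemma tilde_carrier: "tilde c \<in> carrier G"
  using s by (auto simp: tilde_eq subst_carrier_iff formal_sol_nth fps_eq_iff)

lemma bar_carrier: "bar b \<in> carrier G"
  using s by (auto simp: subst_carrier_iff bar_Phi_nth fps_eq_iff)

lemma lin_carrier: "c \<in> roots1 l \<Longrightarrow> lin c \<in> carrier G"
  using s roots1_nonzero by (auto simp: subst_carrier_iff lin_nth fps_eq_iff)

lemma mult_eqI:
  assumes "f \<in> carrier G" "g \<in> carrier G" "h \<in> carrier G"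
    and "\<And>j. j \<le> s \<Longrightarrow> fps_nth (f oo g) j = fps_nth h j"
  shows "f \<otimes>\<^bsub>G\<^esub> g = h"
  using assms(4) by (intro subst_carrier_cong_eq[of _ "enat s"] G.m_closed assms(1-3))
    (simp add: subst_mult fcong_def)

lemma tilde_mult: "tilde c \<otimes>\<^bsub>G\<^esub> tilde d = tilde (c + d)"
proof -
  have "fcong s (tilde c oo tilde d) (formal_sol l \<delta> c oo formal_sol l \<delta> d)"
    by (rule fcong_compose) (simp_all add: tilde_eq)
  then show ?thesis
    by (simp add: subst_mult tilde_eq[of "c + d"] formal_sol_compose fps_trunc_eq_iff)
qed

lemma tilde_bar_nth:
  "j \<le> s \<Longrightarrow> fps_nth (tilde c \<otimes>\<^bsub>G\<^esub> bar b) j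
    = fps_nth (formal_sol l \<delta> c) j + (if s - l + 1 \<le> j then b j else 0)"
  using fps_compose_near_id[of l "tilde c" "s - l" "bar b" j] tilde_near_id[of _ c] bar_near_id[of _ b] l s
  by (simp add: subst_mult bar_Phi_nth tilde_eq)

text \<open>
  Both products are the sum \<open>tilde + bar - x\<close>, because the orders \<open>l\<close> and \<open>s - l\<close> up to which the two
  series agree with \<open>x\<close> add up to \<open>s\<close>.
\<close>

lemma tilde_bar_commute: "tilde c \<otimes>\<^bsub>G\<^esub> bar b = bar b \<otimes>\<^bsub>G\<^esub> tilde c"
proof (rule sym, rule mult_eqI)
  fix j assume "j \<le> s"
  then show "fps_nth (bar b oo tilde c) j = fps_nth (tilde c \<otimes>\<^bsub>G\<^esub> bar b) j"
    using fps_compose_near_id[of "s - l" "bar b" l "tilde c" j] tilde_near_id[of _ c] bar_near_id[of _ b] l s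
    by (simp only: tilde_bar_nth) (simp add: bar_Phi_nth tilde_eq)
qed (simp_all add: tilde_carrier bar_carrier)

lemma bar_mult: "bar b \<otimes>\<^bsub>G\<^esub> bar d = bar (\<lambda>j. b j + d j)"
proof (rule mult_eqI)
  fix j assume "j \<le> s"
  then show "fps_nth (bar b oo bar d) j = fps_nth (bar (\<lambda>j. b j + d j)) j"
    using fps_compose_near_id[of "s - l" "bar b" "s - l" "bar d" j] bar_near_id[of _ b] bar_near_id[of _ d] l s
    by (simp add: bar_Phi_nth)
qed (simp_all add: bar_carrier)

lemma lin_mult:
  assumes "c \<in> roots1 l" "d \<in> roots1 l"
  shows "c * d \<in> roots1 l" "lin c \<otimes>\<^bsub>G\<^esub> lin d = lin (c * d)"
proof -
  show "c * d \<in> roots1 l" using assms by (simp add: roots1_def power_mult_distrib)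
  then show "lin c \<otimes>\<^bsub>G\<^esub> lin d = lin (c * d)"
    using assms by (intro mult_eqI lin_carrier) (simp_all add: lin_compose lin_nth)
qed

lemma roots1_power:
  assumes "d \<in> roots1 l" "1 \<le> j" "l dvd j - 1"
  shows "d ^ j = d"
proof -
  obtain p where p: "j - 1 = l * p" using assms(3) by auto
  then have "j = Suc (l * p)" using assms(2) by linarith
  then show ?thesis using assms(1) by (simp add: roots1_def power_mult)
qed

lemma tilde_lin_commute:
  assumes "d \<in> roots1 l"
  shows "tilde c \<otimes>\<^bsub>G\<^esub> lin d = lin d \<otimes>\<^bsub>G\<^esub> tilde c"
proof (rule mult_eqI)
  fix j assume j: "j \<le> s"
  have "d ^ j * fps_nth (formal_sol l \<delta> c) j = d * fps_nth (formal_sol l \<delta> c) j"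
    using formal_sol_nth(3)[of j l \<delta> c] roots1_power[OF assms, of j]
    by (cases "j = 0"; cases "l dvd j - 1") (auto simp: formal_sol_nth(1))
  then show "fps_nth (tilde c oo lin d) j = fps_nth (lin d \<otimes>\<^bsub>G\<^esub> tilde c) j"
    using j by (simp add: compose_lin_nth subst_mult lin_compose tilde_eq formal_sol_nth(1))
qed (use assms in \<open>simp_all add: lin_carrier tilde_carrier\<close>)

lemma bar_lin_commute:
  assumes "d \<in> roots1 l"
  shows "bar b \<otimes>\<^bsub>G\<^esub> lin d = lin d \<otimes>\<^bsub>G\<^esub> bar (\<lambda>j. d ^ (j - 1) * b j)"
proof (rule mult_eqI)
  fix j assume j: "j \<le> s"
  have "d ^ j = d * d ^ (j - 1)" if "1 \<le> j"
    using that by (cases j) auto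
  then have "fps_nth (bar b oo lin d) j = fps_nth (lin d oo bar (\<lambda>j. d ^ (j - 1) * b j)) j"
    using top_range by (auto simp: compose_lin_nth lin_compose bar_Phi_nth)
  then show "fps_nth (bar b oo lin d) j = fps_nth (lin d \<otimes>\<^bsub>G\<^esub> bar (\<lambda>j. d ^ (j - 1) * b j)) j"
    using j by (simp add: subst_mult)
qed (use assms in \<open>simp_all add: lin_carrier bar_carrier\<close>)

lemma bar_cong: "(\<And>j. j \<in> J l s \<Longrightarrow> b j = d j) \<Longrightarrow> bar b = bar d"
  by (rule fps_ext) (simp add: bar_Phi_nth J_def)

lemma tilde_sol: "tilde c \<in> AJ_sols s Ht"
proof -
  have "transports s (tilde c) Ht Ht"
    by (rule transports_cong[OF _ _ formal_sol_transports[OF l, of _ _ c]]) (simp_all add: tilde_eq normal_form_low)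
  then show ?thesis using tilde_carrier by (simp add: AJ_sols_iff)
qed

lemma lin_sol:
  assumes "c \<in> roots1 l"
  shows "lin c \<in> AJ_sols s Ht"
proof -
  have "c ^ (l + 1) = c" "c ^ (2 * l + 1) = c"
    using roots1_power[OF assms, of "l + 1"] roots1_power[OF assms, of "2 * l + 1"] by simp_all
  then have "Ht oo lin c = fps_deriv (lin c) * Ht"
    by (intro fps_ext)
       (auto simp: normal_form_def compose_lin_nth lin_def fps_X_power_nth simp del: power_Suc)
  then show ?thesis using lin_carrier[OF assms] by (simp add: AJ_sols_iff transports_def)
qed

text \<open>
  The perturbation starts at \<open>x ^ (s-l+1)\<close>. It is multiplied by \<open>l\<close> further powers of \<open>x\<close> on the left
  side, and its derivative by \<open>l + 1\<close> of them on the right side, so neither side notices it.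
\<close>

lemma bar_sol: "bar b \<in> AJ_sols s Ht"
proof -
  define h where "h = bar b - fps_X"
  have h: "fps_nth h j = 0" if "j \<le> s - l" for j
    using that bar_near_id[of j b] by (simp add: h_def)
  have bar: "fps_deriv (bar b) * Ht = Ht + fps_deriv h * Ht"
    by (simp add: h_def algebra_simps)
  have rhs: "fps_nth (fps_deriv h * Ht) j = 0" if "j \<le> s" for j
    unfolding fps_mult_nth
  proof (rule sum.neutral, rule ballI)
    fix i assume i: "i \<in> {0..j}"
    show "fps_nth (fps_deriv h) i * fps_nth Ht (j - i) = 0"
    proof (cases "i + 1 \<le> s - l")
      case False
      then have "j - i \<le> l" using that i by auto
      then show ?thesis by (simp only: normal_form_low mult_zero_right)
    qed (simp add: h)
  qed
  have lhs: "fps_nth (Ht oo bar b) j = fps_nth Ht j" if "j \<le> s" for j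
  proof -
    have "fps_nth (bar b ^ Suc k) j = fps_nth (fps_X ^ Suc k) j" if "l \<le> k" for k
      using that \<open>j \<le> s\<close> s bar_near_id[of _ b]
      by (intro fps_power_nth_agree[of _ "s - l + 1"]) (auto simp: bar_Phi_nth)
    from this[of l] this[of "2 * l"] show ?thesis
      using normal_form_compose[of "bar b" l \<delta>] bar_near_id[of 0 b] by (simp add: normal_form_def)
  qed
  have "transports s (bar b) Ht Ht"
    unfolding transports_def bar using lhs rhs by (simp add: fcong_def)
  then show ?thesis using bar_carrier by (simp add: AJ_sols_iff)
qed

lemmas sols = tilde_sol lin_sol bar_sol

lemma sols_closed: "f \<in> AJ_sols s Ht \<Longrightarrow> g \<in> AJ_sols s Ht \<Longrightarrow> f \<otimes>\<^bsub>G\<^esub> g \<in> AJ_sols s Ht"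
  using K.m_closed by (simp add: AJ_group_simps)

lemma hat_sol: "c1 \<in> roots1 l \<Longrightarrow> hat c1 c \<in> AJ_sols s Ht"
  unfolding hat_Phi_def by (intro sols_closed sols)

lemma hat_nth:
  assumes "c1 \<in> roots1 l" "j \<le> s"
  shows "fps_nth (hat c1 c) j
    = c1 * fps_nth (formal_sol l \<delta> (inverse c1 * c (l + 1))) j + (if s - l + 1 \<le> j then c j else 0)"
proof -
  let ?f = "tilde (inverse c1 * c (l + 1)) \<otimes>\<^bsub>G\<^esub> bar (\<lambda>j. inverse c1 * c j)"
  have "?f \<in> carrier G" by (intro G.m_closed tilde_carrier bar_carrier)
  then have "fps_nth (hat c1 c) j = c1 * fps_nth ?f j"
    using assms(2) by (simp add: hat_Phi_def subst_mult[of _ "lin c1"] lin_compose subst_carrier_iff)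
  then show ?thesis
    using roots1_nonzero[OF assms(1)] by (simp add: tilde_bar_nth[OF assms(2)] field_simps)
qed

lemma hat_nth_params:
  assumes "c1 \<in> roots1 l"
  shows "fps_nth (hat c1 c) 1 = c1" "fps_nth (hat c1 c) (l + 1) = c (l + 1)"
proof -
  have "1 \<le> s" "l + 1 \<le> s" "\<not> s - l + 1 \<le> 1" "\<not> s - l + 1 \<le> l + 1" using l s by auto
  then show "fps_nth (hat c1 c) 1 = c1" "fps_nth (hat c1 c) (l + 1) = c (l + 1)"
    using hat_nth[OF assms, of 1 c] hat_nth[OF assms, of "l + 1" c] roots1_nonzero[OF assms]
      formal_sol_nth(2)[of l \<delta>] formal_sol_free by simp_all
qed

text \<open>
  The two progressions of exponents overlap in the single exponent \<open>r l + 1\<close>, which therefore gets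
  a term of its own.
\<close>

lemma hat_expansion:
  assumes c1: "c1 \<in> roots1 l"
  shows "hat c1 c =
    fps_const c1 * fps_X + fps_const (c (l + 1)) * fps_X ^ (l + 1)
    + (\<Sum>p = 2..r - 1. fps_const (c1 * eval_yt (Q l p) (inverse c1 * c (l + 1)) \<delta>) * fps_X ^ (p * l + 1))
    + (\<Sum>j = s - l + 1..r * l. fps_const (c j) * fps_X ^ j)
    + fps_const (c1 * eval_yt (Q l r) (inverse c1 * c (l + 1)) \<delta> + c (r * l + 1)) * fps_X ^ (r * l + 1)
    + (\<Sum>j = r * l + 2..s. fps_const (c j) * fps_X ^ j)"
proof -
  define x where "x = inverse c1 * c (l + 1)"
  define a where "a p = eval_yt (Q l p) x \<delta>" for p
  have "{2..r} = insert r {2..r - 1}" using r2 by auto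
  then have t: "tilde x = fps_X + fps_const x * fps_X ^ (l + 1)
      + ((\<Sum>p = 2..r - 1. fps_const (a p) * fps_X ^ (p * l + 1)) + fps_const (a r) * fps_X ^ (r * l + 1))"
    using r2 by (simp add: tilde_Phi_def a_def algebra_simps)
  have "{s - l + 1..s} = insert (r * l + 1) ({s - l + 1..r * l} \<union> {r * l + 2..s})"
    using top_range r by auto
  then have b: "(\<Sum>j = s - l + 1..s. fps_const (c j) * fps_X ^ j)
     = (\<Sum>j = s - l + 1..r * l. fps_const (c j) * fps_X ^ j)
       + fps_const (c (r * l + 1)) * fps_X ^ (r * l + 1)
       + (\<Sum>j = r * l + 2..s. fps_const (c j) * fps_X ^ j)"
    by (simp add: sum.union_disjoint algebra_simps del: power_Suc)
  have "hat c1 c = fps_const c1 * tilde x + (\<Sum>j = s - l + 1..s. fps_const (c j) * fps_X ^ j)"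
  proof (rule fps_ext)
    fix j
    have "fps_nth (\<Sum>j = s - l + 1..s. fps_const (c j) * fps_X ^ j) j
        = (if j \<in> {s - l + 1..s} then c j else 0)"
      using bar_Phi_nth[of l s c j] by (simp add: bar_Phi_def)
    moreover have "fps_nth (hat c1 c) j = 0" if "\<not> j \<le> s"
      using that by (simp add: hat_Phi_def subst_mult[of _ "lin c1"])
    ultimately show "fps_nth (hat c1 c) j
        = fps_nth (fps_const c1 * tilde x + (\<Sum>j = s - l + 1..s. fps_const (c j) * fps_X ^ j)) j"
      using hat_nth[OF c1, of j c] by (cases "j \<le> s") (simp_all add: tilde_eq x_def)
  qed
  moreover have cx: "c1 * x = c (l + 1)"
    using roots1_nonzero[OF c1] by (simp add: x_def)
  ultimately show ?thesis
    unfolding t b a_def[symmetric] x_def[symmetric]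
    by (simp add: distrib_left sum_distrib_left fps_const_add[symmetric] distrib_right
        add_ac cx[simplified] del: power_Suc fps_const_add flip: mult.assoc)
qed

text \<open>
  The second rotation moves to the left through \<open>bar\<close>, rescaling its parameters, and through \<open>tilde\<close>;
  afterwards equal types of factors are adjacent and add up.
\<close>

lemma hat_mult:
  assumes c1: "c1 \<in> roots1 l" and d1: "d1 \<in> roots1 l"
  shows "hat c1 c \<otimes>\<^bsub>G\<^esub> hat d1 d = hat (c1 * d1) (\<lambda>j\<in>J l s. c1 * d j + d1 ^ j * c j)"
proof -
  note nz = roots1_nonzero[OF c1] roots1_nonzero[OF d1]
  note closed = tilde_carrier bar_carrier lin_carrier[OF c1] lin_carrier[OF d1]
  define x y where "x = inverse c1 * c (l + 1)" and "y = inverse d1 * d (l + 1)"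
  define u v where "u = (\<lambda>j. inverse c1 * c j)" and "v = (\<lambda>j. inverse d1 * d j)"
  define w where "w = (\<lambda>j. d1 ^ (j - 1) * u j)"
  have "hat c1 c \<otimes>\<^bsub>G\<^esub> hat d1 d
      = lin c1 \<otimes>\<^bsub>G\<^esub> (tilde x \<otimes>\<^bsub>G\<^esub> (bar u \<otimes>\<^bsub>G\<^esub> lin d1)) \<otimes>\<^bsub>G\<^esub> (tilde y \<otimes>\<^bsub>G\<^esub> bar v)"
    unfolding hat_Phi_def x_def y_def u_def v_def by (simp add: G.m_assoc closed)
  also have "bar u \<otimes>\<^bsub>G\<^esub> lin d1 = lin d1 \<otimes>\<^bsub>G\<^esub> bar w"
    unfolding w_def by (rule bar_lin_commute[OF d1])
  also have "tilde x \<otimes>\<^bsub>G\<^esub> (lin d1 \<otimes>\<^bsub>G\<^esub> bar w) = (tilde x \<otimes>\<^bsub>G\<^esub> lin d1) \<otimes>\<^bsub>G\<^esub> bar w"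
    by (simp add: G.m_assoc closed)
  also have "tilde x \<otimes>\<^bsub>G\<^esub> lin d1 = lin d1 \<otimes>\<^bsub>G\<^esub> tilde x"
    by (rule tilde_lin_commute[OF d1])
  also have "lin c1 \<otimes>\<^bsub>G\<^esub> (lin d1 \<otimes>\<^bsub>G\<^esub> tilde x \<otimes>\<^bsub>G\<^esub> bar w) \<otimes>\<^bsub>G\<^esub> (tilde y \<otimes>\<^bsub>G\<^esub> bar v)
      = (lin c1 \<otimes>\<^bsub>G\<^esub> lin d1) \<otimes>\<^bsub>G\<^esub> (tilde x \<otimes>\<^bsub>G\<^esub> ((bar w \<otimes>\<^bsub>G\<^esub> tilde y) \<otimes>\<^bsub>G\<^esub> bar v))"
    by (simp add: G.m_assoc closed)
  also have "bar w \<otimes>\<^bsub>G\<^esub> tilde y = tilde y \<otimes>\<^bsub>G\<^esub> bar w"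
    by (rule tilde_bar_commute[symmetric])
  also have "tilde x \<otimes>\<^bsub>G\<^esub> ((tilde y \<otimes>\<^bsub>G\<^esub> bar w) \<otimes>\<^bsub>G\<^esub> bar v)
      = (tilde x \<otimes>\<^bsub>G\<^esub> tilde y) \<otimes>\<^bsub>G\<^esub> (bar w \<otimes>\<^bsub>G\<^esub> bar v)"
    by (simp add: G.m_assoc closed)
  also have "\<dots> = tilde (x + y) \<otimes>\<^bsub>G\<^esub> bar (\<lambda>j. w j + v j)"
    by (simp only: tilde_mult bar_mult)
  also have "lin c1 \<otimes>\<^bsub>G\<^esub> lin d1 = lin (c1 * d1)"
    by (rule lin_mult[OF c1 d1])
  also have "x + y = inverse (c1 * d1) * (\<lambda>j\<in>J l s. c1 * d j + d1 ^ j * c j) (l + 1)"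
  proof -
    have "d1 ^ (l + 1) = d1" using d1 by (intro roots1_power) auto
    then show ?thesis using nz by (simp add: J_def x_def y_def field_simps del: power_Suc)
  qed
  also have "bar (\<lambda>j. w j + v j) = bar (\<lambda>j. inverse (c1 * d1) * (\<lambda>j\<in>J l s. c1 * d j + d1 ^ j * c j) j)"
  proof (rule bar_cong)
    fix j assume j: "j \<in> J l s"
    then have "1 \<le> j" by (auto simp: J_def)
    then have "d1 ^ j = d1 * d1 ^ (j - 1)" by (cases j) auto
    then show "w j + v j = inverse (c1 * d1) * (\<lambda>j\<in>J l s. c1 * d j + d1 ^ j * c j) j"
      using nz j by (simp add: w_def u_def v_def field_simps)
  qed
  finally show ?thesis unfolding hat_Phi_def .
qed

lemma hat_inj:
  assumes "c1 \<in> roots1 l" "d1 \<in> roots1 l" "c \<in> extensional (J l s)" "d \<in> extensional (J l s)"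
    and eq: "hat c1 c = hat d1 d"
  shows "c1 = d1 \<and> c = d"
proof -
  have 1: "c1 = d1" using hat_nth_params(1)[OF assms(1), of c] hat_nth_params(1)[OF assms(2), of d] eq by simp
  have 2: "c (l + 1) = d (l + 1)"
    using hat_nth_params(2)[OF assms(1), of c] hat_nth_params(2)[OF assms(2), of d] eq by simp
  have "c j = d j" if "j \<in> {s - l + 1..s}" for j
    using hat_nth[OF assms(1), of j c] hat_nth[OF assms(2), of j d] that eq 1 2 by simp
  then have "c j = d j" if "j \<in> J l s" for j
    using that 2 by (auto simp: J_def)
  then show ?thesis using 1 assms(3,4) by (auto intro: extensionalityI)
qed

text \<open>
  The equation at \<open>x ^ (l+1)\<close> forces the multiplier to be a root of unity. The parameters are then read
  off from the free coefficients of \<open>F\<close>, and rigidity covers all others.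
\<close>

lemma hat_surj:
  assumes F: "F \<in> AJ_sols s Ht"
  shows "\<exists>c1\<in>roots1 l. \<exists>c\<in>J l s \<rightarrow>\<^sub>E UNIV. F = hat c1 c"
proof -
  define c1 where "c1 = fps_nth F 1"
  have F': "fps_trunc s F = F" "fps_nth F 0 = 0" "c1 \<noteq> 0" "transports s F Ht Ht"
    using F by (auto simp: AJ_sols_iff subst_carrier_iff c1_def)
  have "fps_nth (Ht oo F) (l + 1) = c1 ^ (l + 1)"
    using normal_form_compose[OF F'(2), of l \<delta>] startsby_zero_power_nth_same[OF F'(2), of "l + 1"]
      startsby_zero_power_prefix[OF F'(2), of "2 * l + 1"] l
    by (simp add: c1_def del: power_Suc)
  moreover have "fps_nth (fps_deriv F * Ht) (l + 1) = c1"
    unfolding normal_form_deriv_nth using l by (simp add: c1_def)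
  moreover have "enat (l + 1) \<le> s" using s by simp
  ultimately have "c1 ^ (l + 1) = c1"
    using F'(4) unfolding transports_def fcong_def by metis
  then have c1: "c1 \<in> roots1 l" using F'(3) by (simp add: roots1_def)
  define x where "x = fps_nth F (l + 1)"
  define c where "c = (\<lambda>j\<in>J l s. if j = l + 1 then x
    else fps_nth F j - c1 * fps_nth (formal_sol l \<delta> (inverse c1 * x)) j)"
  have cx: "c (l + 1) = x" by (simp add: c_def J_def)
  have sol: "transports s (hat c1 c) Ht Ht" "fps_nth (hat c1 c) 0 = 0"
    using hat_sol[OF c1, of c] by (auto simp: AJ_sols_iff subst_carrier_iff)
  have "fps_nth F m = fps_nth (hat c1 c) m" for m
  proof -
    consider "m + l \<le> s" | "m \<in> {s - l + 1..s}" | "s < m" using s by fastforce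
    then show ?thesis
    proof cases
      case 1
      show ?thesis
      proof (rule AJ_solution_unique[OF F'(4) sol(1) F'(2) sol(2)])
        show "fps_nth F 1 = fps_nth (hat c1 c) 1" "fps_nth F 1 \<in> roots1 l"
          unfolding c1_def[symmetric] hat_nth_params[OF c1] using c1 by simp_all
        show "fps_nth F (l + 1) = fps_nth (hat c1 c) (l + 1)"
          unfolding hat_nth_params[OF c1] cx x_def ..
      qed (use 1 in simp)
    next
      case 2
      then have "m \<noteq> l + 1" "m \<in> J l s" using top_range by (auto simp: J_def)
      then have "c m = fps_nth F m - c1 * fps_nth (formal_sol l \<delta> (inverse c1 * x)) m"
        by (simp add: c_def)
      then show ?thesis using 2 hat_nth[OF c1, of m c] cx by simp
    next
      case 3
      have "fps_trunc s (hat c1 c) = hat c1 c"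
        using hat_sol[OF c1, of c] by (simp add: AJ_sols_iff subst_carrier_iff)
      then have "fps_nth (hat c1 c) m = 0" "fps_nth F m = 0"
        using 3 F'(1) fps_trunc_nth[of s _ m] by (metis enat_ord_simps(1) linorder_not_less)+
      then show ?thesis by simp
    qed
  qed
  then have "F = hat c1 c" by (rule fps_ext)
  moreover have "c \<in> J l s \<rightarrow>\<^sub>E UNIV" by (simp add: c_def)
  ultimately show ?thesis using c1 by blast
qed

lemma hat_unique_params:
  assumes "F \<in> AJ_sols s Ht"
  shows "\<exists>!(c1, c). c1 \<in> roots1 l \<and> c \<in> J l s \<rightarrow>\<^sub>E UNIV \<and> F = hat c1 c"
proof -
  obtain c1 c where c: "c1 \<in> roots1 l" "c \<in> J l s \<rightarrow>\<^sub>E UNIV" "F = hat c1 c"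
    using hat_surj[OF assms] by blast
  show ?thesis
  proof (rule ex1I[of _ "(c1, c)"])
    fix p assume "case p of (d1, d) \<Rightarrow> d1 \<in> roots1 l \<and> d \<in> J l s \<rightarrow>\<^sub>E UNIV \<and> F = hat d1 d"
    then show "p = (c1, c)" using hat_inj[of c1 "fst p" c "snd p"] c by (cases p) (auto simp: PiE_iff)
  qed (use c in simp)
qed

text \<open>
  It is easier to check the homomorphism property for the parametrisation; its inverse inherits it, as the
  diamond operation does not leave the parameter set.
\<close>

lemma diamond_iso: "AJ_group s Ht \<cong> (diamond_group l s :: ('a \<times> (nat \<Rightarrow> 'a)) monoid)"
proof (rule is_isoI)
  let ?D = "diamond_group l s :: ('a \<times> (nat \<Rightarrow> 'a)) monoid"
  let ?h = "\<lambda>(c1, c). hat c1 c"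
  let ?g = "inv_into (carrier ?D) ?h"
  have D: "carrier ?D = roots1 l \<times> (J l s \<rightarrow>\<^sub>E UNIV)" by (simp add: diamond_group_def)
  have bij: "bij_betw ?h (carrier ?D) (AJ_sols s Ht)"
    unfolding bij_betw_def
  proof
    show "inj_on ?h (carrier ?D)"
      using hat_inj by (fastforce simp: inj_on_def D PiE_iff)
    show "?h ` carrier ?D = AJ_sols s Ht"
      using hat_sol hat_surj by (fastforce simp: D image_iff)
  qed
  have closed: "p \<otimes>\<^bsub>?D\<^esub> q \<in> carrier ?D" if "p \<in> carrier ?D" "q \<in> carrier ?D" for p q
    using that lin_mult(1) by (auto simp: diamond_group_def)
  have hom: "?h (p \<otimes>\<^bsub>?D\<^esub> q) = ?h p \<otimes>\<^bsub>G\<^esub> ?h q" if "p \<in> carrier ?D" "q \<in> carrier ?D" for p q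
    using that hat_mult by (auto simp: diamond_group_def)
  have "?g \<in> hom (AJ_group s Ht) ?D"
  proof (rule homI)
    fix F K assume "F \<in> carrier (AJ_group s Ht)" "K \<in> carrier (AJ_group s Ht)"
    then obtain p q where p: "p \<in> carrier ?D" "F = ?h p" and q: "q \<in> carrier ?D" "K = ?h q"
      using bij unfolding bij_betw_def AJ_group_simps by blast
    have inv: "?g (?h x) = x" if "x \<in> carrier ?D" for x
      using bij that by (rule bij_betw_inv_into_left)
    show "?g F \<in> carrier ?D" using p inv by simp
    have "?g (F \<otimes>\<^bsub>G\<^esub> K) = ?g (?h (p \<otimes>\<^bsub>?D\<^esub> q))" using hom[OF p(1) q(1)] p q by simp
    also have "\<dots> = p \<otimes>\<^bsub>?D\<^esub> q" by (rule inv[OF closed[OF p(1) q(1)]])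
    also have "\<dots> = ?g F \<otimes>\<^bsub>?D\<^esub> ?g K" using inv[OF p(1)] inv[OF q(1)] p q by simp
    finally show "?g (F \<otimes>\<^bsub>AJ_group s Ht\<^esub> K) = ?g F \<otimes>\<^bsub>?D\<^esub> ?g K" by (simp add: AJ_group_simps)
  qed
  then show "?g \<in> iso (AJ_group s Ht) ?D"
    using bij_betw_inv_into[OF bij] by (simp add: iso_def AJ_group_simps)
qed

abbreviation "N \<equiv> AJ_sols1 (enat s) Ht"

lemma N_iff: "F \<in> N \<longleftrightarrow> F \<in> AJ_sols s Ht \<and> fps_nth F 1 = 1"
  by (auto simp: AJ_sols1_def subst_group1_def AJ_sols_iff)

lemma mult_nth_1: "fps_nth (f \<otimes>\<^bsub>G\<^esub> g) 1 = fps_nth f 1 * fps_nth g 1"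
  using s fps_compose_nth_1[of f g] by (simp add: subst_mult)

lemma K_inv_nth_1:
  assumes "F \<in> AJ_sols s Ht"
  shows "fps_nth (inv\<^bsub>AJ_group s Ht\<^esub> F) 1 * fps_nth F 1 = 1"
  using K.l_inv[of F] assms mult_nth_1[of "inv\<^bsub>AJ_group s Ht\<^esub> F" F] by (simp add: AJ_group_simps subst_one)

text \<open>
  The multiplier is a homomorphism to the nonzero scalars, and this is its kernel.
\<close>

lemma N_normal: "N \<lhd> AJ_group s Ht"
  unfolding K.normal_inv_iff
proof (intro conjI ballI)
  show "subgroup N (AJ_group s Ht)"
  proof (rule K.subgroupI)
    show "N \<subseteq> carrier (AJ_group s Ht)" by (auto simp: N_iff AJ_group_simps)
    have "fps_X \<in> N" using K.one_closed by (simp add: N_iff AJ_group_simps subst_one)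
    then show "N \<noteq> {}" by blast
    fix F assume F: "F \<in> N"
    then have "inv\<^bsub>AJ_group s Ht\<^esub> F \<in> AJ_sols s Ht"
      using K.inv_closed[of F] by (simp add: N_iff AJ_group_simps)
    then show "inv\<^bsub>AJ_group s Ht\<^esub> F \<in> N"
      using F K_inv_nth_1[of F] by (simp add: N_iff)
    fix F' assume F': "F' \<in> N"
    then show "F \<otimes>\<^bsub>AJ_group s Ht\<^esub> F' \<in> N"
      using F sols_closed mult_nth_1[of F F'] by (simp add: N_iff AJ_group_simps)
  qed
  fix x F assume x: "x \<in> carrier (AJ_group s Ht)" and F: "F \<in> N"
  let ?i = "inv\<^bsub>AJ_group s Ht\<^esub> x"
  have "x \<otimes>\<^bsub>AJ_group s Ht\<^esub> F \<otimes>\<^bsub>AJ_group s Ht\<^esub> ?i \<in> carrier (AJ_group s Ht)"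
    using x F by (intro K.m_closed K.inv_closed) (auto simp: N_iff AJ_group_simps)
  moreover have "fps_nth (x \<otimes>\<^bsub>AJ_group s Ht\<^esub> F \<otimes>\<^bsub>AJ_group s Ht\<^esub> ?i) 1 = 1"
    using K_inv_nth_1[of x] x F mult_nth_1 by (simp add: AJ_group_simps N_iff mult_ac)
  ultimately show "x \<otimes>\<^bsub>AJ_group s Ht\<^esub> F \<otimes>\<^bsub>AJ_group s Ht\<^esub> ?i \<in> N"
    by (simp add: N_iff AJ_group_simps)
qed

lemma tilde_bar_in_N: "tilde x \<in> N" "bar b \<in> N"
  using sols tilde_near_id[of 1 x] bar_near_id[of 1 b] l s by (auto simp: N_iff)

lemma N_decompose:
  assumes "F \<in> N"
  obtains x b where "F = tilde x \<otimes>\<^bsub>G\<^esub> bar b"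
proof -
  obtain c1 c where c: "c1 \<in> roots1 l" "F = hat c1 c"
    using hat_surj[of F] assms unfolding N_iff by blast
  then have "c1 = 1" using assms hat_nth_params(1)[OF c(1), of c] by (simp add: N_iff)
  have *: "lin 1 = \<one>\<^bsub>G\<^esub>" by (simp add: lin_def subst_one)
  have "F = tilde (c (l + 1)) \<otimes>\<^bsub>G\<^esub> bar c"
    unfolding c(2) hat_Phi_def \<open>c1 = 1\<close> * by (simp add: tilde_carrier bar_carrier)
  then show ?thesis by (rule that)
qed

lemma lin_subgroup: "subgroup (lin ` roots1 l) (AJ_group s Ht)"
proof (rule K.subgroupI)
  show "lin ` roots1 l \<subseteq> carrier (AJ_group s Ht)" by (auto simp: AJ_group_simps lin_sol)
  have "(1 :: 'a) \<in> roots1 l" by (simp add: roots1_def)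
  then show "lin ` roots1 l \<noteq> ({} :: 'a fps set)" by blast
  fix F :: "'a fps" assume "F \<in> lin ` roots1 l"
  then obtain c where c: "c \<in> roots1 l" "F = lin c" by blast
  then have c': "inverse c \<in> roots1 l" by (simp add: roots1_def power_inverse)
  have "lin (inverse c) \<otimes>\<^bsub>G\<^esub> lin c = \<one>\<^bsub>G\<^esub>"
    using lin_mult(2)[OF c' c(1)] roots1_nonzero[OF c(1)] by (simp add: lin_def subst_one)
  then have "inv\<^bsub>AJ_group s Ht\<^esub> F = lin (inverse c)"
    unfolding c(2) by (intro K.inv_equality) (auto simp: AJ_group_simps lin_sol c c')
  then show "inv\<^bsub>AJ_group s Ht\<^esub> F \<in> lin ` roots1 l" using c' by simp
  fix F' :: "'a fps" assume "F' \<in> lin ` roots1 l"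
  then show "F \<otimes>\<^bsub>AJ_group s Ht\<^esub> F' \<in> lin ` roots1 l"
    using c lin_mult by (auto simp: AJ_group_simps)
qed

lemma semidirect: "internal_semidirect (AJ_group s Ht) (lin ` roots1 l) N"
  unfolding internal_semidirect_def
proof (intro conjI lin_subgroup N_normal)
  show "carrier (AJ_group s Ht) = lin ` roots1 l <#>\<^bsub>AJ_group s Ht\<^esub> N"
  proof
    show "carrier (AJ_group s Ht) \<subseteq> lin ` roots1 l <#>\<^bsub>AJ_group s Ht\<^esub> N"
    proof
      fix F assume "F \<in> carrier (AJ_group s Ht)"
      then obtain c1 c where c: "c1 \<in> roots1 l" "F = hat c1 c"
        using hat_surj[of F] unfolding AJ_group_simps by blast
      let ?n = "tilde (inverse c1 * c (l + 1)) \<otimes>\<^bsub>G\<^esub> bar (\<lambda>j. inverse c1 * c j)"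
      have "?n \<in> N" using tilde_bar_in_N sols_closed mult_nth_1 by (simp add: N_iff)
      then show "F \<in> lin ` roots1 l <#>\<^bsub>AJ_group s Ht\<^esub> N"
        using c unfolding set_mult_def hat_Phi_def AJ_group_simps by blast
    qed
    show "lin ` roots1 l <#>\<^bsub>AJ_group s Ht\<^esub> N \<subseteq> carrier (AJ_group s Ht)"
      by (auto simp: set_mult_def AJ_group_simps N_iff intro: sols_closed lin_sol)
  qed
  have "\<one>\<^bsub>AJ_group s Ht\<^esub> = lin 1" by (simp add: AJ_group_simps subst_one lin_def)
  moreover have "1 \<in> roots1 l" by (simp add: roots1_def)
  moreover have "lin 1 \<in> N" using lin_sol[OF \<open>1 \<in> roots1 l\<close>] by (simp add: N_iff lin_nth)
  ultimately show "lin ` roots1 l \<inter> N = {\<one>\<^bsub>AJ_group s Ht\<^esub>}"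
    by (auto simp: N_iff lin_nth)
qed

text \<open>
  Every element is a product of one \<open>tilde\<close> and one \<open>bar\<close>, and such products commute. This makes
  every subgroup normal, so that the decomposition into the two families is direct.
\<close>

lemma N_comm_group: "comm_group ((AJ_group s Ht)\<lparr>carrier := N\<rparr>)"
proof -
  interpret N: group "(AJ_group s Ht)\<lparr>carrier := N\<rparr>"
    by (rule K.subgroup_imp_group) (use N_normal in \<open>simp add: normal_imp_subgroup\<close>)
  show ?thesis
  proof (rule N.group_comm_groupI)
    fix F K assume "F \<in> carrier ((AJ_group s Ht)\<lparr>carrier := N\<rparr>)" "K \<in> carrier ((AJ_group s Ht)\<lparr>carrier := N\<rparr>)"
    then obtain x b y d where F: "F = tilde x \<otimes>\<^bsub>G\<^esub> bar b" and K: "K = tilde y \<otimes>\<^bsub>G\<^esub> bar d"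
      by (auto elim!: N_decompose)
    have product: "(tilde x \<otimes>\<^bsub>G\<^esub> bar b) \<otimes>\<^bsub>G\<^esub> (tilde y \<otimes>\<^bsub>G\<^esub> bar d) = tilde (x + y) \<otimes>\<^bsub>G\<^esub> bar (\<lambda>j. b j + d j)"
      for x y b d
    proof -
      have "(tilde x \<otimes>\<^bsub>G\<^esub> bar b) \<otimes>\<^bsub>G\<^esub> (tilde y \<otimes>\<^bsub>G\<^esub> bar d)
          = tilde x \<otimes>\<^bsub>G\<^esub> (bar b \<otimes>\<^bsub>G\<^esub> tilde y) \<otimes>\<^bsub>G\<^esub> bar d"
        by (simp add: G.m_assoc tilde_carrier bar_carrier)
      also have "bar b \<otimes>\<^bsub>G\<^esub> tilde y = tilde y \<otimes>\<^bsub>G\<^esub> bar b" by (rule tilde_bar_commute[symmetric])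
      also have "tilde x \<otimes>\<^bsub>G\<^esub> (tilde y \<otimes>\<^bsub>G\<^esub> bar b) \<otimes>\<^bsub>G\<^esub> bar d
          = (tilde x \<otimes>\<^bsub>G\<^esub> tilde y) \<otimes>\<^bsub>G\<^esub> (bar b \<otimes>\<^bsub>G\<^esub> bar d)"
        by (simp add: G.m_assoc tilde_carrier bar_carrier)
      finally show ?thesis by (simp only: tilde_mult bar_mult)
    qed
    show "F \<otimes>\<^bsub>(AJ_group s Ht)\<lparr>carrier := N\<rparr>\<^esub> K = K \<otimes>\<^bsub>(AJ_group s Ht)\<lparr>carrier := N\<rparr>\<^esub> F"
      by (simp add: AJ_group_simps F K product add.commute)
  qed
qed

lemma trunc_AJ_sols1_infinity: "fps_trunc s ` AJ_sols1 \<infinity> Ht = range tilde"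
proof -
  have "AJ_sols1 \<infinity> Ht = range (formal_sol l \<delta>)"
    using AJ_sols1_infinity_iff by blast
  then show ?thesis by (simp add: tilde_eq[abs_def] image_image)
qed

lemma AJ_top_sols_range: "AJ_top_sols l s = range bar"
  by (auto simp: AJ_top_sols_def)

lemma tilde_0: "tilde 0 = fps_X" and bar_0: "bar (\<lambda>_. 0) = fps_X"
proof -
  have "tilde 0 \<otimes>\<^bsub>G\<^esub> tilde 0 = tilde 0" by (simp add: tilde_mult)
  then show "tilde 0 = fps_X"
    using G.l_cancel_one[OF tilde_carrier tilde_carrier] by (simp add: subst_one)
  show "bar (\<lambda>_. 0) = fps_X" by (simp add: bar_Phi_def)
qed

lemma direct:
  "internal_direct ((AJ_group s Ht)\<lparr>carrier := N\<rparr>) (fps_trunc s ` AJ_sols1 \<infinity> Ht) (AJ_top_sols l s)"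
proof -
  let ?M = "(AJ_group s Ht)\<lparr>carrier := N\<rparr>"
  interpret M: comm_group ?M by (rule N_comm_group)
  have mult: "f \<otimes>\<^bsub>?M\<^esub> g = f \<otimes>\<^bsub>G\<^esub> g" for f g by (simp add: AJ_group_simps)
  have one: "\<one>\<^bsub>?M\<^esub> = fps_X" by (simp add: AJ_group_simps subst_one)
  have inv_tilde: "inv\<^bsub>?M\<^esub> (tilde x) = tilde (- x)" for x
    by (rule M.inv_equality) (simp_all add: AJ_group_simps subst_one tilde_mult tilde_0 tilde_bar_in_N)
  have inv_bar: "inv\<^bsub>?M\<^esub> (bar b) = bar (\<lambda>j. - b j)" for b
    by (rule M.inv_equality) (simp_all add: AJ_group_simps subst_one bar_mult bar_0 tilde_bar_in_N)
  have A: "subgroup (range tilde) ?M"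
    by (rule M.subgroupI) (auto simp: inv_tilde AJ_group_simps tilde_mult tilde_bar_in_N)
  have B: "subgroup (range bar) ?M"
    by (rule M.subgroupI) (auto simp: inv_bar AJ_group_simps bar_mult tilde_bar_in_N)
  have AB: "carrier ?M = range tilde <#>\<^bsub>?M\<^esub> range bar"
  proof
    show "carrier ?M \<subseteq> range tilde <#>\<^bsub>?M\<^esub> range bar"
    proof
      fix F assume "F \<in> carrier ?M"
      then have "F \<in> N" by simp
      then obtain x b where "F = tilde x \<otimes>\<^bsub>G\<^esub> bar b" by (rule N_decompose)
      then show "F \<in> range tilde <#>\<^bsub>?M\<^esub> range bar" unfolding set_mult_def mult by blast
    qed
    show "range tilde <#>\<^bsub>?M\<^esub> range bar \<subseteq> carrier ?M"
      using M.set_mult_closed[of "range tilde" "range bar"] tilde_bar_in_N by auto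
  qed
  have "F = fps_X" if F: "F \<in> range tilde" "F \<in> range bar" for F
  proof -
    obtain x b where x: "F = tilde x" and b: "F = bar b" using F by blast
    have "x = fps_nth F (l + 1)"
      using formal_sol_free[of x] s by (simp add: x tilde_eq)
    also have "\<dots> = 0" using bar_near_id[of "l + 1" b] l s by (simp add: b)
    finally show ?thesis by (simp add: x tilde_0)
  qed
  moreover have "fps_X \<in> range tilde" "fps_X \<in> range bar"
    using tilde_0 bar_0 by (metis rangeI)+
  ultimately have "range tilde \<inter> range bar = {\<one>\<^bsub>?M\<^esub>}"
    unfolding one by blast
  then show ?thesis
    unfolding internal_direct_def internal_semidirect_def trunc_AJ_sols1_infinity AJ_top_sols_range
    using A B AB M.subgroup_imp_normal by blast
qed

end


section \<open>Transport along an isomorphism\<close>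

lemma iso_internal_semidirect:
  assumes \<phi>: "\<phi> \<in> iso G K" and G: "group G" and K: "group K" and sd: "internal_semidirect G H N"
  shows "internal_semidirect K (\<phi> ` H) (\<phi> ` N)"
proof -
  have hom: "group_hom G K \<phi>"
    using \<phi> G K by (simp add: group_hom_def group_hom_axioms_def iso_def)
  interpret group_hom G K \<phi> by (rule hom)
  have inj: "inj_on \<phi> (carrier G)" and surj: "\<phi> ` carrier G = carrier K"
    using \<phi> by (auto simp: iso_def bij_betw_def)
  have H: "subgroup H G" and N: "N \<lhd> G" and HN: "carrier G = H <#>\<^bsub>G\<^esub> N" and int: "H \<inter> N = {\<one>\<^bsub>G\<^esub>}"
    using sd by (auto simp: internal_semidirect_def)
  have sub: "H \<subseteq> carrier G" "N \<subseteq> carrier G"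
    using H N by (auto simp: subgroup.subset normal_imp_subgroup)
  have "\<phi> (h \<otimes>\<^bsub>G\<^esub> n) = \<phi> h \<otimes>\<^bsub>K\<^esub> \<phi> n" if "h \<in> H" "n \<in> N" for h n
    using that sub by (intro hom_mult) auto
  then have "\<phi> ` (H <#>\<^bsub>G\<^esub> N) = \<phi> ` H <#>\<^bsub>K\<^esub> \<phi> ` N"
    by (simp add: set_mult_def image_UN)
  moreover have "\<phi> ` H \<inter> \<phi> ` N = {\<one>\<^bsub>K\<^esub>}"
    using inj_on_image_Int[OF inj sub] int by simp
  ultimately show ?thesis
    using subgroup_img_is_subgroup[OF H] normal.surj_hom_normal_subgroup[OF N hom surj] surj HN
    by (simp add: internal_semidirect_def)
qed

lemma iso_internal_direct:
  assumes \<phi>: "\<phi> \<in> iso G K" and G: "group G" and K: "group K" and d: "internal_direct G H N"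
  shows "internal_direct K (\<phi> ` H) (\<phi> ` N)"
proof -
  have hom: "group_hom G K \<phi>"
    using \<phi> G K by (simp add: group_hom_def group_hom_axioms_def iso_def)
  have "\<phi> ` carrier G = carrier K" using \<phi> by (auto simp: iso_def bij_betw_def)
  then show ?thesis
    using iso_internal_semidirect[OF \<phi> G K] normal.surj_hom_normal_subgroup[OF _ hom] d
    by (auto simp: internal_direct_def)
qed

lemma iso_restrict:
  assumes "\<phi> \<in> iso G K" "N \<subseteq> carrier G"
  shows "\<phi> \<in> iso (G\<lparr>carrier := N\<rparr>) (K\<lparr>carrier := \<phi> ` N\<rparr>)"
  using assms by (auto simp: iso_def hom_def bij_betw_def inj_on_def Pi_iff) blast+

lemma (in group) cancel_inv_left:
  assumes "t \<in> carrier G" "z \<in> carrier G"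
  shows "inv t \<otimes> (t \<otimes> z) = z" "t \<otimes> (inv t \<otimes> z) = z"
  using assms by (simp_all flip: m_assoc)

text \<open>
  Conjugation composes three transports, \<open>H\<close> to \<open>Ht\<close> to \<open>Ht\<close> to \<open>H\<close>, so it maps solutions to solutions;
  conjugation by the inverse goes back in the same way.
\<close>

lemma conj_iso:
  fixes T H Ht :: "'a::field_char_0 fps" and s :: enat
  defines "G \<equiv> subst_group s :: 'a fps monoid"
  assumes s: "1 \<le> s" and T: "T \<in> carrier G" "transports s T Ht H"
    and H0: "fps_nth H 0 = 0" "fps_nth Ht 0 = 0"
  shows "(\<lambda>F. T \<otimes>\<^bsub>G\<^esub> F \<otimes>\<^bsub>G\<^esub> inv\<^bsub>G\<^esub> T) \<in> iso (AJ_group s Ht) (AJ_group s H)"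
proof -
  interpret group G unfolding G_def by (rule subst_group_is_group[OF s])
  let ?S = "inv\<^bsub>G\<^esub> T"
  have S: "?S \<in> carrier G" "transports s ?S H Ht"
    using T(1) inv_closed[OF T(1)] transports_inv[OF s T(2) H0(2)] by (simp_all add: G_def)
  have conj: "A \<otimes>\<^bsub>G\<^esub> F \<otimes>\<^bsub>G\<^esub> B \<in> AJ_sols s V"
    if F: "F \<in> AJ_sols s W" and A: "A \<in> carrier G" "transports s A W V"
      and B: "B \<in> carrier G" "transports s B V W" and 0: "fps_nth V 0 = 0" "fps_nth W 0 = 0"
    for A B F V W
  proof -
    have F': "F \<in> carrier G" "transports s F W W" using F by (simp_all add: AJ_sols_iff G_def)
    have "transports s (A \<otimes>\<^bsub>G\<^esub> F) W V"
      using A F' 0 unfolding G_def by (intro transports_mult[of s F W W A V])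
    then have "transports s (A \<otimes>\<^bsub>G\<^esub> F \<otimes>\<^bsub>G\<^esub> B) V V"
      using A F' B 0 m_closed[OF A(1) F'(1)] unfolding G_def by (intro transports_mult[of s B V W])
    then show ?thesis using A B F' by (simp add: AJ_sols_iff G_def[symmetric])
  qed
  have sub: "F \<in> carrier G" if "F \<in> AJ_sols s W" for F W
    using that by (simp add: AJ_sols_iff G_def)
  have "bij_betw (\<lambda>F. T \<otimes>\<^bsub>G\<^esub> F \<otimes>\<^bsub>G\<^esub> ?S) (AJ_sols s Ht) (AJ_sols s H)"
  proof (rule bij_betw_byWitness[where f' = "\<lambda>F. ?S \<otimes>\<^bsub>G\<^esub> F \<otimes>\<^bsub>G\<^esub> T"])
    show "\<forall>F\<in>AJ_sols s Ht. ?S \<otimes>\<^bsub>G\<^esub> (T \<otimes>\<^bsub>G\<^esub> F \<otimes>\<^bsub>G\<^esub> ?S) \<otimes>\<^bsub>G\<^esub> T = F"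
      using T(1) sub by (simp add: m_assoc cancel_inv_left)
    show "\<forall>F\<in>AJ_sols s H. T \<otimes>\<^bsub>G\<^esub> (?S \<otimes>\<^bsub>G\<^esub> F \<otimes>\<^bsub>G\<^esub> T) \<otimes>\<^bsub>G\<^esub> ?S = F"
      using T(1) sub by (simp add: m_assoc cancel_inv_left)
  qed (use conj T S H0 in auto)
  moreover have "(\<lambda>F. T \<otimes>\<^bsub>G\<^esub> F \<otimes>\<^bsub>G\<^esub> ?S) \<in> hom (AJ_group s Ht) (AJ_group s H)"
  proof (rule homI)
    fix F K assume "F \<in> carrier (AJ_group s Ht)" "K \<in> carrier (AJ_group s Ht)"
    then have FK: "F \<in> carrier G" "K \<in> carrier G" using sub by (simp_all add: AJ_group_simps)
    show "T \<otimes>\<^bsub>G\<^esub> (F \<otimes>\<^bsub>AJ_group s Ht\<^esub> K) \<otimes>\<^bsub>G\<^esub> ?S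
        = (T \<otimes>\<^bsub>G\<^esub> F \<otimes>\<^bsub>G\<^esub> ?S) \<otimes>\<^bsub>AJ_group s H\<^esub> (T \<otimes>\<^bsub>G\<^esub> K \<otimes>\<^bsub>G\<^esub> ?S)"
      using FK T(1) S(1) by (simp add: AJ_group_simps m_assoc cancel_inv_left flip: G_def)
  qed (use conj T S H0 in \<open>auto simp: AJ_group_simps\<close>)
  ultimately show ?thesis by (simp add: iso_def AJ_group_simps)
qed

lemma (in group) conj_mult:
  assumes "t \<in> carrier G" "x \<in> carrier G" "y \<in> carrier G"
  shows "t \<otimes> (x \<otimes> y) \<otimes> inv t = (t \<otimes> x \<otimes> inv t) \<otimes> (t \<otimes> y \<otimes> inv t)"
  using assms by (simp add: m_assoc cancel_inv_left)

lemma conj_set_eq: "conj_set G t A = (\<lambda>f. t \<otimes>\<^bsub>G\<^esub> f \<otimes>\<^bsub>G\<^esub> inv\<^bsub>G\<^esub> t) ` A"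
  by (auto simp: conj_set_def)

section \<open>The general equation\<close>

lemma greatest_progression_index:
  fixes l s r :: nat
  assumes "1 \<le> l" "l + 1 \<le> s" and r: "r = (GREATEST p. p \<ge> 1 \<and> p * l + 1 \<le> s)"
  shows "r * l + 1 \<le> s" "s \<le> (r + 1) * l"
proof -
  let ?P = "\<lambda>p. p \<ge> 1 \<and> p * l + 1 \<le> s"
  have bound: "p \<le> s" if "?P p" for p
  proof -
    have "p * 1 \<le> p * l" using assms(1) by (intro mult_le_mono2) simp
    then show ?thesis using that by linarith
  qed
  have "?P 1" using assms by simp
  then have P: "?P r" unfolding r by (rule GreatestI_nat) (use bound in blast)
  then show "r * l + 1 \<le> s" by blast
  show "s \<le> (r + 1) * l"
  proof (rule ccontr)
    assume "\<not> s \<le> (r + 1) * l"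
    then have "?P (r + 1)" by simp
    then have "r + 1 \<le> r" unfolding r by (rule Greatest_le_nat) (use bound in blast)
    then show False by simp
  qed
qed

theorem corollary6:
  fixes l s r :: nat
    and h :: "nat \<Rightarrow> 'a::field_char_0"
    and \<delta> :: 'a
    and H Ht T :: "'a fps"
  assumes "l \<ge> 1"
    and "s \<ge> 2 * l + 1"
    and "H = fps_X ^ (l + 1) + (\<Sum>j = l + 2..s. fps_const (h j) * fps_X ^ j)"
    and "Ht = fps_X ^ (l + 1) + fps_const \<delta> * fps_X ^ (2 * l + 1)"
    and "T \<in> subst_group1 s"
    and "AJ_transforms s T H Ht"
    and "r = (GREATEST p. p \<ge> 1 \<and> p * l + 1 \<le> s)"
  shows "
    \<comment> \<open>the series \<open>tilde_Phi\<close> as truncations of solutions over \<open>k[[x]]\<close>\<close>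
    (\<forall>c. (\<exists>!\<Phi>. \<Phi> \<in> AJ_sols1 \<infinity> Ht \<and> fps_nth \<Phi> (l + 1) = c) \<and>
         (\<forall>\<Phi>. \<Phi> \<in> AJ_sols1 \<infinity> Ht \<and> fps_nth \<Phi> (l + 1) = c \<longrightarrow>
              tilde_Phi l r \<delta> c = fps_trunc s \<Phi>)) \<and>
    \<comment> \<open>part (i)\<close>
    (\<forall>c1 \<in> roots1 l. \<forall>c \<in> J l s \<rightarrow>\<^sub>E UNIV.
       hat_Phi l s r \<delta> c1 c =
         fps_const c1 * fps_X + fps_const (c (l + 1)) * fps_X ^ (l + 1)
         + (\<Sum>p = 2..r - 1. fps_const (c1 * eval_yt (Q l p) (inverse c1 * c (l + 1)) \<delta>)
                              * fps_X ^ (p * l + 1))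
         + (\<Sum>j = s - l + 1..r * l. fps_const (c j) * fps_X ^ j)
         + fps_const (c1 * eval_yt (Q l r) (inverse c1 * c (l + 1)) \<delta> + c (r * l + 1))
             * fps_X ^ (r * l + 1)
         + (\<Sum>j = r * l + 2..s. fps_const (c j) * fps_X ^ j) \<and>
       hat_Phi l s r \<delta> c1 c \<in> AJ_sols s Ht) \<and>
    (\<forall>F \<in> AJ_sols s Ht. \<exists>!(c1, c). c1 \<in> roots1 l \<and> c \<in> J l s \<rightarrow>\<^sub>E UNIV \<and>
       F = hat_Phi l s r \<delta> c1 c) \<and>
    (\<exists>N. internal_semidirect (AJ_group s Ht) (lin ` roots1 l) N \<and>
         internal_direct ((AJ_group s Ht)\<lparr>carrier := N\<rparr>)
           (fps_trunc s ` AJ_sols1 \<infinity> Ht) (AJ_top_sols l s)) \<and>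
    AJ_group s Ht \<cong> (diamond_group l s :: ('a \<times> (nat \<Rightarrow> 'a)) monoid) \<and>
    \<comment> \<open>part (ii)\<close>
    (\<forall>c1 \<in> roots1 l. \<forall>c \<in> J l s \<rightarrow>\<^sub>E UNIV.
       T \<otimes>\<^bsub>subst_group s\<^esub> hat_Phi l s r \<delta> c1 c \<otimes>\<^bsub>subst_group s\<^esub> inv\<^bsub>subst_group s\<^esub> T =
         (T \<otimes>\<^bsub>subst_group s\<^esub> lin c1 \<otimes>\<^bsub>subst_group s\<^esub> inv\<^bsub>subst_group s\<^esub> T)
         \<otimes>\<^bsub>subst_group s\<^esub>
         (T \<otimes>\<^bsub>subst_group s\<^esub> tilde_Phi l r \<delta> (inverse c1 * c (l + 1))
            \<otimes>\<^bsub>subst_group s\<^esub> inv\<^bsub>subst_group s\<^esub> T)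
         \<otimes>\<^bsub>subst_group s\<^esub>
         (T \<otimes>\<^bsub>subst_group s\<^esub> bar_Phi l s (\<lambda>j. inverse c1 * c j)
            \<otimes>\<^bsub>subst_group s\<^esub> inv\<^bsub>subst_group s\<^esub> T) \<and>
       T \<otimes>\<^bsub>subst_group s\<^esub> hat_Phi l s r \<delta> c1 c \<otimes>\<^bsub>subst_group s\<^esub> inv\<^bsub>subst_group s\<^esub> T
         \<in> AJ_sols s H) \<and>
    (\<forall>F \<in> AJ_sols s H. \<exists>!(c1, c). c1 \<in> roots1 l \<and> c \<in> J l s \<rightarrow>\<^sub>E UNIV \<and>
       F = T \<otimes>\<^bsub>subst_group s\<^esub> hat_Phi l s r \<delta> c1 c \<otimes>\<^bsub>subst_group s\<^esub> inv\<^bsub>subst_group s\<^esub> T) \<and>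
    (\<exists>N. internal_semidirect (AJ_group s H) (conj_set (subst_group s) T (lin ` roots1 l)) N \<and>
         internal_direct ((AJ_group s H)\<lparr>carrier := N\<rparr>)
           (conj_set (subst_group s) T (fps_trunc s ` AJ_sols1 \<infinity> Ht))
           (conj_set (subst_group s) T (AJ_top_sols l s))) \<and>
    AJ_group s H \<cong> (diamond_group l s :: ('a \<times> (nat \<Rightarrow> 'a)) monoid)"
proof -
  note l = \<open>l \<ge> 1\<close> and s = \<open>s \<ge> 2 * l + 1\<close>
  have rl: "r * l + 1 \<le> s" "s \<le> (r + 1) * l"
    using greatest_progression_index[OF l _ assms(7)] s by auto
  interpret normal_form_setting l s r \<delta>
    by unfold_locales (use l s rl in auto)
  have Ht: "Ht = normal_form l \<delta>"
    using assms(4) by (simp add: normal_form_def)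
  have Ht0: "fps_nth (normal_form l \<delta>) 0 = 0" by (rule normal_form_low) simp
  have H0: "fps_nth H 0 = 0"
    unfolding assms(3) by (simp add: fps_sum_nth)
  let ?conj = "\<lambda>F. T \<otimes>\<^bsub>G\<^esub> F \<otimes>\<^bsub>G\<^esub> inv\<^bsub>G\<^esub> T"
  have T: "T \<in> carrier G" "fps_nth T 1 \<noteq> 0"
    using assms(5) by (auto simp: subst_group1_def)
  have "fps_trunc s (normal_form l \<delta>) = normal_form l \<delta>"
    using s by (auto simp: fps_eq_iff normal_form_def fps_X_power_nth simp del: power_Suc)
  then have transp: "transports s T (normal_form l \<delta>) H"
    using AJ_transforms_iff_transports[OF T(2)] assms(6) Ht by blast
  have iso: "?conj \<in> iso (AJ_group s (normal_form l \<delta>)) (AJ_group s H)"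
    by (rule conj_iso[OF s1 T(1) transp H0 Ht0])
  then have bij: "bij_betw ?conj (AJ_sols s (normal_form l \<delta>)) (AJ_sols s H)"
    by (simp add: iso_def AJ_group_simps)
  have group_H: "group (AJ_group s H)" by (rule AJ_group_is_group[OF s1 H0])
  let ?N = "AJ_sols1 s (normal_form l \<delta>)"
  have N_sub: "?N \<subseteq> carrier (AJ_group s (normal_form l \<delta>))"
    by (auto simp: AJ_sols1_def AJ_group_simps)
  have sd_H: "internal_semidirect (AJ_group s H) (?conj ` lin ` roots1 l) (?conj ` ?N)"
    by (rule iso_internal_semidirect[OF iso K.group_axioms group_H semidirect])
  then have "subgroup (?conj ` ?N) (AJ_group s H)"
    by (simp add: internal_semidirect_def normal_imp_subgroup)
  then have group_N_H: "group ((AJ_group s H)\<lparr>carrier := ?conj ` ?N\<rparr>)"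
    by (rule group.subgroup_imp_group[OF group_H])
  have group_N: "group ((AJ_group s (normal_form l \<delta>))\<lparr>carrier := ?N\<rparr>)"
    using N_comm_group by (simp add: comm_group_def)
  show ?thesis
    unfolding Ht
  proof (intro conjI)
    show "\<forall>c. (\<exists>!\<Phi>. \<Phi> \<in> AJ_sols1 \<infinity> (normal_form l \<delta>) \<and> fps_nth \<Phi> (l + 1) = c) \<and>
         (\<forall>\<Phi>. \<Phi> \<in> AJ_sols1 \<infinity> (normal_form l \<delta>) \<and> fps_nth \<Phi> (l + 1) = c \<longrightarrow>
              tilde_Phi l r \<delta> c = fps_trunc s \<Phi>)"
    proof -
      have "\<Phi> \<in> AJ_sols1 \<infinity> (normal_form l \<delta>) \<and> fps_nth \<Phi> (l + 1) = c \<longleftrightarrow> \<Phi> = formal_sol l \<delta> c"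
        for \<Phi> c
        unfolding AJ_sols1_infinity_iff using formal_sol_free by metis
      then show ?thesis by (simp add: tilde_eq)
    qed
    show "\<forall>c1\<in>roots1 l. \<forall>c\<in>J l s \<rightarrow>\<^sub>E UNIV.
       hat_Phi l s r \<delta> c1 c =
         fps_const c1 * fps_X + fps_const (c (l + 1)) * fps_X ^ (l + 1)
         + (\<Sum>p = 2..r - 1. fps_const (c1 * eval_yt (Q l p) (inverse c1 * c (l + 1)) \<delta>)
                              * fps_X ^ (p * l + 1))
         + (\<Sum>j = s - l + 1..r * l. fps_const (c j) * fps_X ^ j)
         + fps_const (c1 * eval_yt (Q l r) (inverse c1 * c (l + 1)) \<delta> + c (r * l + 1))
             * fps_X ^ (r * l + 1)
         + (\<Sum>j = r * l + 2..s. fps_const (c j) * fps_X ^ j) \<and>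
       hat_Phi l s r \<delta> c1 c \<in> AJ_sols s (normal_form l \<delta>)"
      using hat_expansion hat_sol by blast
    show "\<forall>F\<in>AJ_sols s (normal_form l \<delta>). \<exists>!(c1, c). c1 \<in> roots1 l \<and> c \<in> J l s \<rightarrow>\<^sub>E UNIV \<and>
       F = hat_Phi l s r \<delta> c1 c"
      using hat_unique_params by blast
    show "\<exists>N. internal_semidirect (AJ_group s (normal_form l \<delta>)) (lin ` roots1 l) N \<and>
         internal_direct ((AJ_group s (normal_form l \<delta>))\<lparr>carrier := N\<rparr>)
           (fps_trunc s ` AJ_sols1 \<infinity> (normal_form l \<delta>)) (AJ_top_sols l s)"
      using semidirect direct by blast
    show "AJ_group s (normal_form l \<delta>) \<cong> (diamond_group l s :: ('a \<times> (nat \<Rightarrow> 'a)) monoid)"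
      by (rule diamond_iso)
    show "\<forall>c1\<in>roots1 l. \<forall>c\<in>J l s \<rightarrow>\<^sub>E UNIV.
       ?conj (hat_Phi l s r \<delta> c1 c) =
         ?conj (lin c1) \<otimes>\<^bsub>G\<^esub> ?conj (tilde_Phi l r \<delta> (inverse c1 * c (l + 1)))
         \<otimes>\<^bsub>G\<^esub> ?conj (bar_Phi l s (\<lambda>j. inverse c1 * c j)) \<and>
       ?conj (hat_Phi l s r \<delta> c1 c) \<in> AJ_sols s H"
    proof (intro ballI conjI)
      fix c1 :: 'a and c :: "nat \<Rightarrow> 'a" assume c1: "c1 \<in> roots1 l"
      show "?conj (hat_Phi l s r \<delta> c1 c) =
         ?conj (lin c1) \<otimes>\<^bsub>G\<^esub> ?conj (tilde_Phi l r \<delta> (inverse c1 * c (l + 1)))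
         \<otimes>\<^bsub>G\<^esub> ?conj (bar_Phi l s (\<lambda>j. inverse c1 * c j))"
        unfolding hat_Phi_def
        by (simp only: G.conj_mult G.m_assoc G.cancel_inv_left T(1) lin_carrier[OF c1] tilde_carrier bar_carrier
            G.m_closed G.inv_closed)
      show "?conj (hat_Phi l s r \<delta> c1 c) \<in> AJ_sols s H"
        using bij hat_sol[OF c1] by (rule bij_betw_apply)
    qed
    show "\<forall>F\<in>AJ_sols s H. \<exists>!(c1, c). c1 \<in> roots1 l \<and> c \<in> J l s \<rightarrow>\<^sub>E UNIV \<and>
       F = ?conj (hat_Phi l s r \<delta> c1 c)"
    proof
      fix F assume "F \<in> AJ_sols s H"
      then obtain E where E: "E \<in> AJ_sols s (normal_form l \<delta>)" "F = ?conj E"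
        using bij unfolding bij_betw_def by blast
      have "F = ?conj (hat_Phi l s r \<delta> c1 c) \<longleftrightarrow> E = hat_Phi l s r \<delta> c1 c" if "c1 \<in> roots1 l" for c1 c
        using bij E hat_sol[OF that] unfolding bij_betw_def by (auto dest: inj_onD)
      then have "(case p of (c1, c) \<Rightarrow> c1 \<in> roots1 l \<and> c \<in> J l s \<rightarrow>\<^sub>E UNIV \<and>
            F = ?conj (hat_Phi l s r \<delta> c1 c))
          \<longleftrightarrow> (case p of (c1, c) \<Rightarrow> c1 \<in> roots1 l \<and> c \<in> J l s \<rightarrow>\<^sub>E UNIV \<and> E = hat_Phi l s r \<delta> c1 c)" for p
        by (auto split: prod.splits)
      then show "\<exists>!(c1, c). c1 \<in> roots1 l \<and> c \<in> J l s \<rightarrow>\<^sub>E UNIV \<and> F = ?conj (hat_Phi l s r \<delta> c1 c)"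
        using hat_unique_params[OF E(1)] by presburger
    qed
    show "\<exists>N. internal_semidirect (AJ_group s H) (conj_set G T (lin ` roots1 l)) N \<and>
         internal_direct ((AJ_group s H)\<lparr>carrier := N\<rparr>)
           (conj_set G T (fps_trunc s ` AJ_sols1 \<infinity> (normal_form l \<delta>)))
           (conj_set G T (AJ_top_sols l s))"
      using sd_H iso_internal_direct[OF iso_restrict[OF iso N_sub] group_N group_N_H direct]
      unfolding conj_set_eq by blast
    show "AJ_group s H \<cong> (diamond_group l s :: ('a \<times> (nat \<Rightarrow> 'a)) monoid)"
      using iso_trans[OF K.iso_sym[OF is_isoI[OF iso]] diamond_iso] .
  qed
qed

end
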